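(* Let $\mu$ be a positive measure and $1\le p\le\infty$, and let $L_p(\mu)$ denote the corresponding (real or complex) Lebesgue space with its standard norm; assume $L_p(\mu)\neq\{0\}$. Then the norm of $L_p(\mu)$ is uniformly micro-semitransitive if and only if it is a Hilbertian norm, that is, if and only if $p=2$ or $L_p(\mu)$ is one-dimensional. Likewise, the norm of $L_p(\mu)$ is micro-transitive if and only if it is a Hilbertian norm, that is, if and only if $p=2$ or $L_p(\mu)$ is one-dimensional.
   Context: Banach spaces are over $\mathbb{K}=\mathbb{R}$ or $\mathbb{C}$. $S_X$ is the unit sphere of $X$, $\mathcal{L}(X)$ the space of bounded linear operators on $X$ with the operator norm, and $\mathrm{Id}$ the identity operator. The norm of a Banach space $X$ is micro-transitive if the group $G$ of surjective linear isometries of $X$ (with the operator-norm topology) acts micro-transitively on $S_X$: for every $x\in S_X$ and every neighborhood $U$ of $\mathrm{Id}$ in $G$, the set $Ux=\{Tx : T\in U\}$ is a neighborhood of $x$ in $S_X$. The norm of $X$ (or $X$ itself) is uniformly micro-semitransitive if there is a function $\beta:(0,2)\to(0,\infty)$ such that whenever $\varepsilon\in(0,2)$ and $x,y\in S_X$ satisfy $\|x-y\|<\beta(\varepsilon)$, there is $T\in\mathcal{L}(X)$ with $\|T\|=1$, $Tx=y$ and $\|T-\mathrm{Id}\|<\varepsilon$. A norm is Hilbertian if it is induced by an inner product. *)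

theory Defs
  imports "HOL-Probability.Essential_Supremum" "HOL-Analysis.Abstract_Metric_Spaces"
begin

text \<open>
  The space \<open>L\<^sub>p(\<mu>)\<close> depends on the values \<open>p\<close> and \<open>\<mu>\<close>, so it cannot be a type.  Normed spaces
  are therefore given by a carrier and operations that are meaningful on the carrier only.
\<close>

record ('k, 'v) normed_vs =
  vcarrier :: "'v set"
  vzero :: 'v
  vadd :: "'v \<Rightarrow> 'v \<Rightarrow> 'v"
  vscale :: "'k \<Rightarrow> 'v \<Rightarrow> 'v"
  vnorm :: "'v \<Rightarrow> real"

definition vminus :: "('k::real_normed_field, 'v) normed_vs \<Rightarrow> 'v \<Rightarrow> 'v \<Rightarrow> 'v" where
  "vminus X x y = vadd X x (vscale X (- 1) y)"

definition unit_sphere :: "('k, 'v) normed_vs \<Rightarrow> 'v set" where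
  "unit_sphere X = {x \<in> vcarrier X. vnorm X x = 1}"

definition one_dimensional :: "('k, 'v) normed_vs \<Rightarrow> bool" where
  "one_dimensional X \<longleftrightarrow>
     (\<exists>v\<in>vcarrier X. v \<noteq> vzero X \<and> vcarrier X = range (\<lambda>c. vscale X c v))"

text \<open>
  The map \<open>cj\<close> is the conjugation of the scalar field: the identity for real scalars and
  \<open>cnj\<close> for complex scalars.
\<close>

definition inner_product_on ::
    "('k::real_normed_field \<Rightarrow> 'k) \<Rightarrow> ('k, 'v) normed_vs \<Rightarrow> ('v \<Rightarrow> 'v \<Rightarrow> 'k) \<Rightarrow> bool" where
  "inner_product_on cj X ip \<longleftrightarrow>
     (\<forall>x\<in>vcarrier X. \<forall>y\<in>vcarrier X. \<forall>z\<in>vcarrier X. ip (vadd X x y) z = ip x z + ip y z) \<and>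
     (\<forall>c. \<forall>x\<in>vcarrier X. \<forall>y\<in>vcarrier X. ip (vscale X c x) y = c * ip x y) \<and>
     (\<forall>x\<in>vcarrier X. \<forall>y\<in>vcarrier X. ip y x = cj (ip x y)) \<and>
     (\<forall>x\<in>vcarrier X. x \<noteq> vzero X \<longrightarrow> (\<exists>r>0. ip x x = of_real r))"

definition hilbertian_norm ::
    "('k::real_normed_field \<Rightarrow> 'k) \<Rightarrow> ('k, 'v) normed_vs \<Rightarrow> bool" where
  "hilbertian_norm cj X \<longleftrightarrow>
     (\<exists>ip. inner_product_on cj X ip \<and> (\<forall>x\<in>vcarrier X. ip x x = of_real ((vnorm X x)\<^sup>2)))"

text \<open>
  Operators are extensional functions on the carrier, so that equality of operators is equality
  in HOL.
\<close>

definition bounded_operators :: "('k, 'v) normed_vs \<Rightarrow> ('v \<Rightarrow> 'v) set" where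
  "bounded_operators X =
     {T \<in> vcarrier X \<rightarrow>\<^sub>E vcarrier X.
        (\<forall>x\<in>vcarrier X. \<forall>y\<in>vcarrier X. T (vadd X x y) = vadd X (T x) (T y)) \<and>
        (\<forall>c. \<forall>x\<in>vcarrier X. T (vscale X c x) = vscale X c (T x)) \<and>
        (\<exists>B. \<forall>x\<in>vcarrier X. vnorm X (T x) \<le> B * vnorm X x)}"

definition op_id :: "('k, 'v) normed_vs \<Rightarrow> 'v \<Rightarrow> 'v" where
  "op_id X = (\<lambda>x\<in>vcarrier X. x)"

definition op_minus :: "('k::real_normed_field, 'v) normed_vs \<Rightarrow> ('v \<Rightarrow> 'v) \<Rightarrow> ('v \<Rightarrow> 'v) \<Rightarrow> 'v \<Rightarrow> 'v" where
  "op_minus X T S = (\<lambda>x\<in>vcarrier X. vminus X (T x) (S x))"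

definition op_norm :: "('k, 'v) normed_vs \<Rightarrow> ('v \<Rightarrow> 'v) \<Rightarrow> real" where
  "op_norm X T = (SUP x\<in>{x \<in> vcarrier X. vnorm X x \<le> 1}. vnorm X (T x))"

definition isometry_group :: "('k, 'v) normed_vs \<Rightarrow> ('v \<Rightarrow> 'v) set" where
  "isometry_group X =
     {T \<in> bounded_operators X. (\<forall>x\<in>vcarrier X. vnorm X (T x) = vnorm X x) \<and>
        T ` vcarrier X = vcarrier X}"

text \<open>
  The distances are set to \<open>0\<close> outside the underlying sets because the locale
  \<^locale>\<open>Metric_space\<close> asks for nonnegativity and symmetry on the whole type.
\<close>

definition sphere_topology :: "('k::real_normed_field, 'v) normed_vs \<Rightarrow> 'v topology" where
  "sphere_topology X = Metric_space.mtopology (unit_sphere X)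
     (\<lambda>x y. if x \<in> unit_sphere X \<and> y \<in> unit_sphere X then vnorm X (vminus X x y) else 0)"

definition isometry_topology :: "('k::real_normed_field, 'v) normed_vs \<Rightarrow> ('v \<Rightarrow> 'v) topology" where
  "isometry_topology X = Metric_space.mtopology (isometry_group X)
     (\<lambda>S T. if S \<in> isometry_group X \<and> T \<in> isometry_group X
             then op_norm X (op_minus X S T) else 0)"

definition nbhd_in :: "'a topology \<Rightarrow> 'a \<Rightarrow> 'a set \<Rightarrow> bool" where
  "nbhd_in \<tau> x U \<longleftrightarrow> U \<subseteq> topspace \<tau> \<and> (\<exists>V. openin \<tau> V \<and> x \<in> V \<and> V \<subseteq> U)"

definition micro_transitive :: "('k::real_normed_field, 'v) normed_vs \<Rightarrow> bool" where
  "micro_transitive X \<longleftrightarrow>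
     (\<forall>x\<in>unit_sphere X. \<forall>U. nbhd_in (isometry_topology X) (op_id X) U \<longrightarrow>
        nbhd_in (sphere_topology X) x ((\<lambda>T. T x) ` U))"

definition uniformly_micro_semitransitive :: "('k::real_normed_field, 'v) normed_vs \<Rightarrow> bool" where
  "uniformly_micro_semitransitive X \<longleftrightarrow>
     (\<exists>\<beta>::real \<Rightarrow> real. (\<forall>\<epsilon>\<in>{0<..<2}. \<beta> \<epsilon> > 0) \<and>
        (\<forall>\<epsilon>\<in>{0<..<2}. \<forall>x\<in>unit_sphere X. \<forall>y\<in>unit_sphere X. vnorm X (vminus X x y) < \<beta> \<epsilon> \<longrightarrow>
           (\<exists>T\<in>bounded_operators X.
              op_norm X T = 1 \<and> T x = y \<and> op_norm X (op_minus X T (op_id X)) < \<epsilon>)))"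

definition Lp_functions :: "ennreal \<Rightarrow> 'a measure \<Rightarrow> ('a \<Rightarrow> 'k::real_normed_field) set" where
  "Lp_functions p M =
     {f \<in> borel_measurable M.
        if p = \<infinity> then esssup M (\<lambda>x. ennreal (norm (f x))) < \<infinity>
        else integrable M (\<lambda>x. norm (f x) powr enn2real p)}"

definition Lp_seminorm :: "ennreal \<Rightarrow> 'a measure \<Rightarrow> ('a \<Rightarrow> 'k::real_normed_field) \<Rightarrow> real" where
  "Lp_seminorm p M f =
     (if p = \<infinity> then enn2real (esssup M (\<lambda>x. ennreal (norm (f x))))
      else (\<integral>x. norm (f x) powr enn2real p \<partial>M) powr (1 / enn2real p))"

definition Lp_rel :: "ennreal \<Rightarrow> 'a measure \<Rightarrow> (('a \<Rightarrow> 'k::real_normed_field) \<times> ('a \<Rightarrow> 'k)) set" where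
  "Lp_rel p M = {(f, g). f \<in> Lp_functions p M \<and> g \<in> Lp_functions p M \<and> (AE x in M. f x = g x)}"

text \<open>
  The elements of \<open>Lp_space p M\<close> are equivalence classes of functions; the operations and the norm
  do not depend on the representatives, so the unions and the image below are a single class and
  a singleton.
\<close>

definition Lp_space :: "ennreal \<Rightarrow> 'a measure \<Rightarrow> ('k::real_normed_field, ('a \<Rightarrow> 'k) set) normed_vs" where
  "Lp_space p M =
     \<lparr>vcarrier = Lp_functions p M // Lp_rel p M,
      vzero = Lp_rel p M `` {\<lambda>x. 0},
      vadd = (\<lambda>A B. \<Union>f\<in>A. \<Union>g\<in>B. Lp_rel p M `` {\<lambda>x. f x + g x}),
      vscale = (\<lambda>c A. \<Union>f\<in>A. Lp_rel p M `` {\<lambda>x. c * f x}),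
      vnorm = (\<lambda>A. the_elem (Lp_seminorm p M ` A))\<rparr>"

end

theory Submission
  imports Defs
begin

text \<open>
  If the norm comes from an inner product, two unit vectors \<open>x\<close>, \<open>y\<close> at distance \<open>\<delta> \<le> 1\<close> are joined by
  an explicit surjective isometry within \<open>6\<delta>\<close> of the identity, which gives both transitivity properties.

  Conversely, each of them provides, for \<open>y\<close> near \<open>x\<close>, contractions near the identity that send \<open>x\<close> to \<open>y\<close>
  and \<open>y\<close> to \<open>x\<close>.  If \<open>p < \<infinity>\<close> and \<open>L\<^sub>p\<close> is not one-dimensional, two disjoint sets of finite positive measure
  span a copy of two-dimensional \<open>\<ell>\<^sub>p\<close>, onto which averaging is a projection of norm one.
  There the norm deviates from flatness to order \<open>p\<close> at the axis point \<open>a\<close>, in the direction \<open>b\<close>,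
  but to order \<open>2\<close> at nearby points off the axis.
  A contraction cannot send the flatter of two such points to the more curved one without
  nearly annihilating \<open>b\<close>, so \<open>p = 2\<close>.
  For \<open>p = \<infinity>\<close> the constant \<open>1\<close> is an extreme point of the unit ball and \<open>1 - s 1\<^sub>E\<close> is not.
\<close>

text \<open>Both transitivity properties are reduced to the relation \<open>dominated\<close>, which
  compares the norm along a line through x with the norm along a line through y and remembers only
  the image of one direction b. Whether the operator was invertible no longer matters after that. No
  derivative of the norm is taken: values at t and -t are added, which removes the first-order term
  for real and complex scalars alike and covers r = 1. The obstacle is that y must be allowed
  arbitrarily close to a, where its different flatness could become invisible. If \<beta> is the
  b-coordinate of y and the step is t = \<beta> s, every term that survives is \<beta> powr r times
  a function of s. Hence s is fixed by r alone and \<beta> cancels. The measure is arbitrary, so the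
  two disjoint sets are extracted from level sets of members of the space, which have finite
  measure, and not from a decomposition of the measure space.\<close>

section \<open>Transitivity of the norm of an abstract normed space\<close>

text \<open>A contraction \<open>T\<close> with \<open>T x = y\<close> and \<open>\<parallel>T - Id\<parallel> \<le> 1/2\<close> provides the witness \<open>v = T b\<close>.\<close>

definition dominated :: "('k::real_normed_field, 'v) normed_vs \<Rightarrow> 'v \<Rightarrow> 'v \<Rightarrow> bool" where
  "dominated X x y \<longleftrightarrow>
     (\<forall>b\<in>vcarrier X. \<exists>v\<in>vcarrier X. vnorm X (vminus X v b) \<le> vnorm X b / 2 \<and>
        (\<forall>t. vnorm X (vadd X y (vscale X t v)) \<le> vnorm X (vadd X x (vscale X t b))))"

text \<open>Both directions are demanded because the one that fails depends on the exponent: for r <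
  2 and for p = \<infinity> the contradiction comes from \<open>dominated X y x\<close>, for r > 2
  from \<open>dominated X x y\<close>.\<close>

definition locally_dominated :: "('k::real_normed_field, 'v) normed_vs \<Rightarrow> 'v \<Rightarrow> bool" where
  "locally_dominated X x \<longleftrightarrow>
     (\<exists>\<delta>>0. \<forall>y\<in>unit_sphere X. vnorm X (vminus X x y) < \<delta> \<longrightarrow> dominated X x y \<and> dominated X y x)"

locale normed_vector_space =
  fixes X :: "('k::real_normed_field, 'v) normed_vs"
  assumes zero_closed [simp]: "vzero X \<in> vcarrier X"
    and add_closed [simp]: "\<And>x y. \<lbrakk>x \<in> vcarrier X; y \<in> vcarrier X\<rbrakk> \<Longrightarrow> vadd X x y \<in> vcarrier X"
    and scale_closed [simp]: "\<And>c x. x \<in> vcarrier X \<Longrightarrow> vscale X c x \<in> vcarrier X"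
    and add_assoc: "\<And>x y z. \<lbrakk>x \<in> vcarrier X; y \<in> vcarrier X; z \<in> vcarrier X\<rbrakk> \<Longrightarrow>
      vadd X (vadd X x y) z = vadd X x (vadd X y z)"
    and add_commute: "\<And>x y. \<lbrakk>x \<in> vcarrier X; y \<in> vcarrier X\<rbrakk> \<Longrightarrow> vadd X x y = vadd X y x"
    and add_zero [simp]: "\<And>x. x \<in> vcarrier X \<Longrightarrow> vadd X x (vzero X) = x"
    and scale_add: "\<And>c x y. \<lbrakk>x \<in> vcarrier X; y \<in> vcarrier X\<rbrakk> \<Longrightarrow>
      vscale X c (vadd X x y) = vadd X (vscale X c x) (vscale X c y)"
    and add_scale: "\<And>c d x. x \<in> vcarrier X \<Longrightarrow>
      vscale X (c + d) x = vadd X (vscale X c x) (vscale X d x)"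
    and scale_scale: "\<And>c d x. x \<in> vcarrier X \<Longrightarrow> vscale X c (vscale X d x) = vscale X (c * d) x"
    and scale_one [simp]: "\<And>x. x \<in> vcarrier X \<Longrightarrow> vscale X 1 x = x"
    and norm_triangle: "\<And>x y. \<lbrakk>x \<in> vcarrier X; y \<in> vcarrier X\<rbrakk> \<Longrightarrow>
      vnorm X (vadd X x y) \<le> vnorm X x + vnorm X y"
    and norm_scale: "\<And>c x. x \<in> vcarrier X \<Longrightarrow> vnorm X (vscale X c x) = norm c * vnorm X x"
    and norm_eq_zeroD: "\<And>x. \<lbrakk>x \<in> vcarrier X; vnorm X x = 0\<rbrakk> \<Longrightarrow> x = vzero X"
begin

text \<open>Homogeneity and definiteness of the norm give this law; with \<open>add_scale\<close> it
  makes \<open>vscale X (-1) x\<close> the additive inverse of x.\<close>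

lemma scale_zero [simp]: "x \<in> vcarrier X \<Longrightarrow> vscale X 0 x = vzero X"
  by (rule norm_eq_zeroD) (simp_all add: norm_scale)

lemma vnorm_zero [simp]: "vnorm X (vzero X) = 0"
  using norm_scale[of "vzero X" 0] by simp

lemma zero_add [simp]: "x \<in> vcarrier X \<Longrightarrow> vadd X (vzero X) x = x"
  by (simp add: add_commute)

lemma minus_closed [simp]: "\<lbrakk>x \<in> vcarrier X; y \<in> vcarrier X\<rbrakk> \<Longrightarrow> vminus X x y \<in> vcarrier X"
  by (simp add: vminus_def)

lemma minus_self [simp]: "x \<in> vcarrier X \<Longrightarrow> vminus X x x = vzero X"
  using add_scale[of x 1 "-1"] by (simp add: vminus_def)

lemma neg_add [simp]: "x \<in> vcarrier X \<Longrightarrow> vadd X (vscale X (-1) x) x = vzero X"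
  using add_scale[of x "-1" 1] by simp

lemma norm_nonneg [simp]: "x \<in> vcarrier X \<Longrightarrow> 0 \<le> vnorm X x"
  using norm_triangle[of x "vscale X (-1) x"] minus_self[of x]
  by (simp add: norm_scale vminus_def)

lemma add_left_commute:
  "\<lbrakk>x \<in> vcarrier X; y \<in> vcarrier X; z \<in> vcarrier X\<rbrakk> \<Longrightarrow>
     vadd X x (vadd X y z) = vadd X y (vadd X x z)"
  by (metis add_assoc add_commute)

lemma minus_eq_zeroD:
  assumes "x \<in> vcarrier X" "y \<in> vcarrier X" "vminus X x y = vzero X"
  shows "x = y"
proof -
  have "vadd X (vminus X x y) y = x"
    using assms(1,2) by (simp add: vminus_def add_assoc)
  then show ?thesis using assms by simp
qed

lemma vnorm_minus_commute:
  assumes "x \<in> vcarrier X" "y \<in> vcarrier X"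
  shows "vnorm X (vminus X x y) = vnorm X (vminus X y x)"
proof -
  have "vminus X y x = vscale X (-1) (vminus X x y)"
    using assms by (simp add: vminus_def scale_add scale_scale add_commute)
  then show ?thesis using assms by (simp add: norm_scale)
qed

lemma norm_minus_triangle:
  assumes "x \<in> vcarrier X" "y \<in> vcarrier X" "z \<in> vcarrier X"
  shows "vnorm X (vminus X x z) \<le> vnorm X (vminus X x y) + vnorm X (vminus X y z)"
proof -
  have "vminus X x z = vadd X (vminus X x y) (vminus X y z)"
  proof -
    have "vadd X (vscale X (-1) y) (vadd X y (vscale X (-1) z)) = vscale X (-1) z"
      using assms by (simp flip: add_assoc)
    then show ?thesis using assms by (simp add: vminus_def add_assoc)
  qed
  then show ?thesis using norm_triangle assms by simp
qed

lemma norm_minus_eq_zero_iff: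
  "\<lbrakk>x \<in> vcarrier X; y \<in> vcarrier X\<rbrakk> \<Longrightarrow> vnorm X (vminus X x y) = 0 \<longleftrightarrow> x = y"
  by (metis minus_closed minus_eq_zeroD minus_self norm_eq_zeroD vnorm_zero)

section \<open>Bounded operators and the operator norm\<close>

lemma bounded_operatorsD:
  assumes "T \<in> bounded_operators X"
  shows "x \<in> vcarrier X \<Longrightarrow> T x \<in> vcarrier X"
    and "\<lbrakk>x \<in> vcarrier X; y \<in> vcarrier X\<rbrakk> \<Longrightarrow> T (vadd X x y) = vadd X (T x) (T y)"
    and "x \<in> vcarrier X \<Longrightarrow> T (vscale X c x) = vscale X c (T x)"
    and "\<exists>B. \<forall>x\<in>vcarrier X. vnorm X (T x) \<le> B * vnorm X x"
    and "T \<in> extensional (vcarrier X)"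
  using assms by (auto simp: bounded_operators_def PiE_iff)

lemma bounded_operators_zero:
  assumes "T \<in> bounded_operators X"
  shows "T (vzero X) = vzero X"
  using bounded_operatorsD(1,3)[OF assms, of "vzero X"] scale_zero zero_closed by metis

lemma op_id_bounded [simp]: "op_id X \<in> bounded_operators X"
  by (auto simp: bounded_operators_def op_id_def intro!: exI[of _ 1])

lemma op_id_isometry [simp]: "op_id X \<in> isometry_group X"
proof -
  have "op_id X ` vcarrier X = vcarrier X" by (auto simp: op_id_def)
  moreover have "vnorm X (op_id X x) = vnorm X x" if "x \<in> vcarrier X" for x
    using that by (simp add: op_id_def)
  ultimately show ?thesis by (simp add: isometry_group_def)
qed

lemma op_minus_bounded:
  assumes "S \<in> bounded_operators X" "T \<in> bounded_operators X"
  shows "op_minus X S T \<in> bounded_operators X"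
proof -
  note S = bounded_operatorsD[OF assms(1)] and T = bounded_operatorsD[OF assms(2)]
  obtain B C where BC: "\<And>x. x \<in> vcarrier X \<Longrightarrow> vnorm X (S x) \<le> B * vnorm X x"
      "\<And>x. x \<in> vcarrier X \<Longrightarrow> vnorm X (T x) \<le> C * vnorm X x"
    using S(4) T(4) by blast
  have "vnorm X (vminus X (S x) (T x)) \<le> (B + C) * vnorm X x" if "x \<in> vcarrier X" for x
  proof -
    have "vnorm X (vminus X (S x) (T x)) \<le> vnorm X (S x) + vnorm X (T x)"
      using norm_triangle[of "S x" "vscale X (-1) (T x)"] that S T by (simp add: vminus_def norm_scale)
    then show ?thesis using BC[OF that] by (simp add: algebra_simps)
  qed
  then show ?thesis
    unfolding bounded_operators_def op_minus_def
    by (auto simp: S T vminus_def scale_add scale_scale add_assoc add_left_commute intro!: exI[of _ "B + C"])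
qed

lemma op_norm_le:
  assumes "\<And>x. \<lbrakk>x \<in> vcarrier X; vnorm X x \<le> 1\<rbrakk> \<Longrightarrow> vnorm X (T x) \<le> C"
  shows "op_norm X T \<le> C"
  unfolding op_norm_def using assms
  by (intro cSUP_least) (auto intro!: exI[of _ "vzero X"])

lemma norm_le_op_norm:
  assumes T: "T \<in> bounded_operators X" and x: "x \<in> vcarrier X"
  shows "vnorm X (T x) \<le> op_norm X T * vnorm X x"
proof (cases "vnorm X x = 0")
  case True
  then have "x = vzero X" using x norm_eq_zeroD by blast
  then show ?thesis using bounded_operators_zero[OF T] by simp
next
  case False
  define n where "n = vnorm X x"
  have n: "n > 0" using False norm_nonneg[OF x] by (simp add: n_def less_le)
  obtain B where B: "\<And>x. x \<in> vcarrier X \<Longrightarrow> vnorm X (T x) \<le> B * vnorm X x"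
    using bounded_operatorsD(4)[OF T] by blast
  \<comment> \<open>The supremum in \<open>op_norm\<close> is one of reals, so an upper bound has to
    be exhibited before a value can be compared with it. B may be negative, hence the absolute
    value.\<close>
  have bdd: "bdd_above ((\<lambda>x. vnorm X (T x)) ` {x \<in> vcarrier X. vnorm X x \<le> 1})"
  proof (rule bdd_aboveI2)
    fix y assume y: "y \<in> {x \<in> vcarrier X. vnorm X x \<le> 1}"
    have "vnorm X (T y) \<le> B * vnorm X y" using B y by simp
    also have "\<dots> \<le> \<bar>B\<bar> * vnorm X y" using y by (intro mult_right_mono) auto
    also have "\<dots> \<le> \<bar>B\<bar> * 1" using y by (intro mult_left_mono) auto
    finally show "vnorm X (T y) \<le> \<bar>B\<bar>" by simp
  qed
  define z where "z = vscale X (of_real (1 / n)) x"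
  have z: "z \<in> vcarrier X" "vnorm X z = 1"
    using x n by (simp_all add: z_def norm_scale n_def[symmetric] norm_divide)
  have "vnorm X (T z) \<le> op_norm X T"
    unfolding op_norm_def using z by (intro cSUP_upper[OF _ bdd]) auto
  moreover have "vnorm X (T z) = vnorm X (T x) / n"
    using x n T unfolding z_def
    by (simp add: bounded_operatorsD norm_scale norm_divide)
  ultimately show ?thesis using n by (simp add: n_def[symmetric] field_simps)
qed

lemma bounded_operators_eqI:
  assumes "S \<in> bounded_operators X" "T \<in> bounded_operators X"
    and "\<And>x. x \<in> vcarrier X \<Longrightarrow> S x = T x"
  shows "S = T"
  using assms bounded_operatorsD(5) by (metis extensionalityI)

section \<open>The metrics on the sphere and on the isometry group\<close>

lemma Metric_space_sphere:
  "Metric_space (unit_sphere X)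
     (\<lambda>x y. if x \<in> unit_sphere X \<and> y \<in> unit_sphere X then vnorm X (vminus X x y) else 0)"
  by unfold_locales
    (auto simp: unit_sphere_def norm_minus_triangle norm_minus_eq_zero_iff intro: vnorm_minus_commute)

lemma Metric_space_isometry_group:
  "Metric_space (isometry_group X)
     (\<lambda>S T. if S \<in> isometry_group X \<and> T \<in> isometry_group X then op_norm X (op_minus X S T) else 0)"
proof -
  have bo: "S \<in> bounded_operators X" if "S \<in> isometry_group X" for S
    using that by (simp add: isometry_group_def)
  have app: "op_minus X S T x = vminus X (S x) (T x)" if "x \<in> vcarrier X" for S T x
    using that by (simp add: op_minus_def)
  have le: "vnorm X (vminus X (S x) (T x)) \<le> op_norm X (op_minus X S T) * vnorm X x"
    if "S \<in> isometry_group X" "T \<in> isometry_group X" "x \<in> vcarrier X" for S T x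
    using norm_le_op_norm[OF op_minus_bounded[OF bo bo]] that by (simp add: app)
  have nn: "0 \<le> op_norm X (op_minus X S T)"
    if "S \<in> isometry_group X" "T \<in> isometry_group X" for S T
  proof -
    \<comment> \<open>Nonnegativity is read off from the value 0 at the zero vector. The bound
      carries an absolute value because the sign of the operator norm is still open.\<close>
    have "bdd_above ((\<lambda>x. vnorm X (op_minus X S T x)) ` {x \<in> vcarrier X. vnorm X x \<le> 1})"
    proof (rule bdd_aboveI2)
      fix x assume "x \<in> {x \<in> vcarrier X. vnorm X x \<le> 1}"
      then have x: "x \<in> vcarrier X" "vnorm X x \<le> 1" by auto
      have "vnorm X (vminus X (S x) (T x)) \<le> \<bar>op_norm X (op_minus X S T)\<bar> * vnorm X x"
        using le[OF that x(1)] x norm_nonneg[OF x(1)]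
        by (smt (verit, best) mult_right_mono)
      also have "\<dots> \<le> \<bar>op_norm X (op_minus X S T)\<bar>" using x by (simp add: mult_left_le)
      finally show "vnorm X (op_minus X S T x) \<le> \<bar>op_norm X (op_minus X S T)\<bar>"
        using x by (simp add: app)
    qed
    moreover have "vnorm X (op_minus X S T (vzero X)) = 0"
      using bounded_operators_zero[OF op_minus_bounded[OF bo bo]] that by simp
    ultimately show ?thesis
      unfolding op_norm_def by (metis (mono_tags, lifting) cSUP_upper mem_Collect_eq vnorm_zero zero_closed zero_le_one)
  qed
  have le1: "vnorm X (vminus X (S x) (T x)) \<le> op_norm X (op_minus X S T)"
    if "S \<in> isometry_group X" "T \<in> isometry_group X" "x \<in> vcarrier X" "vnorm X x \<le> 1" for S T x
    using le[OF that(1-3)] nn[OF that(1,2)] that(4) mult_left_le by (smt (verit, best))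
  have cl: "S x \<in> vcarrier X" if "S \<in> isometry_group X" "x \<in> vcarrier X" for S x
    using that bo bounded_operatorsD(1) by blast
  have comm: "op_norm X (op_minus X S T) = op_norm X (op_minus X T S)"
    if "S \<in> isometry_group X" "T \<in> isometry_group X" for S T
    unfolding op_norm_def
    by (intro SUP_cong) (use that in \<open>auto simp: app cl vnorm_minus_commute\<close>)
  have eq: "S = T" if "S \<in> isometry_group X" "T \<in> isometry_group X" "op_norm X (op_minus X S T) = 0" for S T
  proof (rule bounded_operators_eqI)
    fix x assume x: "x \<in> vcarrier X"
    then have "vnorm X (vminus X (S x) (T x)) = 0"
      using le[OF that(1,2) x] that cl by (simp add: order_antisym)
    then show "S x = T x" using norm_minus_eq_zero_iff cl that x by blast
  qed (use bo that in auto)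
  have self: "op_norm X (op_minus X S S) = 0" if "S \<in> isometry_group X" for S
    by (rule antisym[OF op_norm_le]) (use that nn in \<open>auto simp: app cl\<close>)
  have tri: "op_norm X (op_minus X S R) \<le> op_norm X (op_minus X S T) + op_norm X (op_minus X T R)"
    if "S \<in> isometry_group X" "T \<in> isometry_group X" "R \<in> isometry_group X" for S T R
  proof (rule op_norm_le)
    fix x assume x: "x \<in> vcarrier X" "vnorm X x \<le> 1"
    have "vnorm X (vminus X (S x) (R x)) \<le> vnorm X (vminus X (S x) (T x)) + vnorm X (vminus X (T x) (R x))"
      using norm_minus_triangle cl that x by blast
    then show "vnorm X (op_minus X S R x) \<le> op_norm X (op_minus X S T) + op_norm X (op_minus X T R)"
      using le1[of S T x] le1[of T R x] that x by (simp add: app)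
  qed
  show ?thesis
    by unfold_locales (use nn comm eq self tri in auto)
qed

section \<open>Domination from the transitivity properties\<close>

lemma dominated_bounded_operator:
  assumes T: "T \<in> bounded_operators X" "op_norm X T \<le> 1" "T x = y" and x: "x \<in> vcarrier X"
    and le: "op_norm X (op_minus X T (op_id X)) \<le> 1 / 2"
  shows "dominated X x y"
  unfolding dominated_def
proof (intro ballI bexI conjI allI)
  fix b assume b: "b \<in> vcarrier X"
  show "T b \<in> vcarrier X" using T b bounded_operatorsD by blast
  have "vnorm X (vminus X (T b) b) \<le> op_norm X (op_minus X T (op_id X)) * vnorm X b"
    using norm_le_op_norm[OF op_minus_bounded[OF T(1) op_id_bounded] b] b
    by (simp add: op_minus_def op_id_def)
  also have "\<dots> \<le> 1 / 2 * vnorm X b" using le b by (intro mult_right_mono) auto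
  finally show "vnorm X (vminus X (T b) b) \<le> vnorm X b / 2" by simp
  fix t
  have "vadd X y (vscale X t (T b)) = T (vadd X x (vscale X t b))"
    using T b x by (simp add: bounded_operatorsD)
  also have "vnorm X \<dots> \<le> op_norm X T * vnorm X (vadd X x (vscale X t b))"
    using T x b by (intro norm_le_op_norm) auto
  also have "\<dots> \<le> 1 * vnorm X (vadd X x (vscale X t b))"
    using T x b by (intro mult_right_mono) auto
  finally show "vnorm X (vadd X y (vscale X t (T b))) \<le> vnorm X (vadd X x (vscale X t b))" by simp
qed

text \<open>The hypothesis is symmetric in the two points, so the single value \<beta>(1/2) serves
  both directions, with unrelated operators.\<close>

lemma locally_dominated_uniformly_micro_semitransitive:
  assumes "uniformly_micro_semitransitive X" "x \<in> unit_sphere X"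
  shows "locally_dominated X x"
proof -
  obtain \<beta> :: "real \<Rightarrow> real" where \<beta>: "\<forall>\<epsilon>\<in>{0<..<2}. \<beta> \<epsilon> > 0"
    and ex: "\<forall>\<epsilon>\<in>{0<..<2}. \<forall>x\<in>unit_sphere X. \<forall>y\<in>unit_sphere X. vnorm X (vminus X x y) < \<beta> \<epsilon> \<longrightarrow>
      (\<exists>T\<in>bounded_operators X. op_norm X T = 1 \<and> T x = y \<and> op_norm X (op_minus X T (op_id X)) < \<epsilon>)"
    using assms(1) unfolding uniformly_micro_semitransitive_def by (elim exE conjE)
  have dom: "dominated X x y" if xy: "x \<in> unit_sphere X" "y \<in> unit_sphere X" "vnorm X (vminus X x y) < \<beta> (1/2)" for x y
    proof -
    have "1/2 \<in> {0<..<2::real}" by simp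
    then obtain T where "T \<in> bounded_operators X" "op_norm X T = 1" "T x = y"
        "op_norm X (op_minus X T (op_id X)) < 1/2"
      using ex[rule_format, OF _ xy] by blast
    then show ?thesis using dominated_bounded_operator[of T x y] xy by (simp add: unit_sphere_def)
  qed
  show ?thesis
    unfolding locally_dominated_def
  proof (intro exI[of _ "\<beta> (1/2)"] conjI ballI impI)
    show "\<beta> (1/2) > 0" using \<beta> by simp
    fix y assume y: "y \<in> unit_sphere X" "vnorm X (vminus X x y) < \<beta> (1/2)"
    then show "dominated X x y" using dom assms(2) by blast
    have "vnorm X (vminus X y x) < \<beta> (1/2)"
      using y assms(2) vnorm_minus_commute[of x y] by (simp add: unit_sphere_def)
    then show "dominated X y x" using dom y assms(2) by blast
  qed
qed

text \<open>The inverse needs no estimate of its own: if v is the preimage of b, then ||v - b|| =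
  ||T v - v|| \<le> ||v|| / 2 = ||b|| / 2, since T preserves norms.\<close>

lemma dominated_isometry_inverse:
  assumes T: "T \<in> isometry_group X" "T x = y" and x: "x \<in> vcarrier X"
    and le: "op_norm X (op_minus X T (op_id X)) \<le> 1 / 2"
  shows "dominated X y x"
  unfolding dominated_def
proof
  fix b assume b: "b \<in> vcarrier X"
  have T': "T \<in> bounded_operators X" "\<And>x. x \<in> vcarrier X \<Longrightarrow> vnorm X (T x) = vnorm X x"
    using T by (auto simp: isometry_group_def)
  obtain v where v: "v \<in> vcarrier X" "b = T v"
    using T(1) b unfolding isometry_group_def by blast
  have "vnorm X (vminus X v b) = vnorm X (vminus X b v)" using vnorm_minus_commute v b by blast
  also have "\<dots> \<le> op_norm X (op_minus X T (op_id X)) * vnorm X v"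
    using norm_le_op_norm[OF op_minus_bounded[OF T'(1) op_id_bounded] v(1)] v
    by (simp add: op_minus_def op_id_def)
  also have "\<dots> \<le> 1 / 2 * vnorm X v" using le v by (intro mult_right_mono) auto
  finally have 1: "vnorm X (vminus X v b) \<le> vnorm X b / 2" using v T' by simp
  have 2: "vnorm X (vadd X x (vscale X t v)) \<le> vnorm X (vadd X y (vscale X t b))" for t
  proof -
    have "vadd X y (vscale X t b) = T (vadd X x (vscale X t v))"
      using T(2) T'(1) v x by (simp add: bounded_operatorsD)
    then show ?thesis using T' v x by simp
  qed
  show "\<exists>v\<in>vcarrier X. vnorm X (vminus X v b) \<le> vnorm X b / 2 \<and>
          (\<forall>t. vnorm X (vadd X x (vscale X t v)) \<le> vnorm X (vadd X y (vscale X t b)))"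
    using 1 2 v by blast
qed

text \<open>Micro-transitivity at x only moves x to nearby points y; the reverse domination comes
  from the inverse of the same isometry.\<close>

lemma locally_dominated_micro_transitive:
  assumes "micro_transitive X" "x \<in> unit_sphere X"
  shows "locally_dominated X x"
proof -
  interpret G: Metric_space "isometry_group X"
    "\<lambda>S T. if S \<in> isometry_group X \<and> T \<in> isometry_group X then op_norm X (op_minus X S T) else 0"
    by (rule Metric_space_isometry_group)
  interpret S: Metric_space "unit_sphere X"
    "\<lambda>x y. if x \<in> unit_sphere X \<and> y \<in> unit_sphere X then vnorm X (vminus X x y) else 0"
    by (rule Metric_space_sphere)
  let ?U = "G.mball (op_id X) (1/2)"
  have "nbhd_in (isometry_topology X) (op_id X) ?U"
    unfolding nbhd_in_def isometry_topology_def
    by (auto intro!: exI[of _ ?U] simp del: G.in_mball simp: G.centre_in_mball_iff)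
      (use G.mball_subset_mspace in blast)
  then have "nbhd_in (sphere_topology X) x ((\<lambda>T. T x) ` ?U)"
    using assms by (simp add: micro_transitive_def)
  then obtain V where V: "openin S.mtopology V" "x \<in> V" "V \<subseteq> (\<lambda>T. T x) ` ?U"
    unfolding nbhd_in_def sphere_topology_def by blast
  then obtain r where r: "r > 0" "S.mball x r \<subseteq> V"
    unfolding S.openin_mtopology by blast
  have "dominated X x y \<and> dominated X y x"
    if y: "y \<in> unit_sphere X" "vnorm X (vminus X x y) < r" for y
  proof -
    have "y \<in> S.mball x r" using y assms(2) by simp
    then obtain T where "T \<in> ?U" and Tx: "T x = y" using r V by blast
    then have T: "T \<in> isometry_group X" "op_norm X (op_minus X (op_id X) T) < 1/2" by auto
    then have le: "op_norm X (op_minus X T (op_id X)) \<le> 1/2"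
      using G.commute[of T "op_id X"] by simp
    have x: "x \<in> vcarrier X" using assms(2) by (simp add: unit_sphere_def)
    have "op_norm X T \<le> 1"
      using T(1) by (intro op_norm_le) (auto simp: isometry_group_def)
    moreover have "T \<in> bounded_operators X" using T(1) by (simp add: isometry_group_def)
    ultimately show ?thesis
      using dominated_bounded_operator[OF _ _ Tx x le] dominated_isometry_inverse[OF T(1) Tx x le]
      by blast
  qed
  then show ?thesis unfolding locally_dominated_def using r by blast
qed

text \<open>The hypothesis, shared with \<open>uniformly_micro_semitransitiveI\<close>, is what
  \<open>exists_isometry\<close> supplies for Hilbertian norms: \<delta> is independent of the two
  points.\<close>

lemma micro_transitiveI:
  assumes "\<And>\<epsilon>. \<epsilon> > 0 \<Longrightarrow> \<exists>\<delta>>0. \<forall>x\<in>unit_sphere X. \<forall>y\<in>unit_sphere X. vnorm X (vminus X x y) < \<delta> \<longrightarrow>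
    (\<exists>T\<in>isometry_group X. T x = y \<and> op_norm X (op_minus X T (op_id X)) < \<epsilon>)"
  shows "micro_transitive X"
  unfolding micro_transitive_def
proof (intro ballI allI impI)
  interpret G: Metric_space "isometry_group X"
    "\<lambda>S T. if S \<in> isometry_group X \<and> T \<in> isometry_group X then op_norm X (op_minus X S T) else 0"
    by (rule Metric_space_isometry_group)
  interpret S: Metric_space "unit_sphere X"
    "\<lambda>x y. if x \<in> unit_sphere X \<and> y \<in> unit_sphere X then vnorm X (vminus X x y) else 0"
    by (rule Metric_space_sphere)
  fix x U assume x: "x \<in> unit_sphere X" and "nbhd_in (isometry_topology X) (op_id X) U"
  then obtain V where V: "openin G.mtopology V" "op_id X \<in> V" "V \<subseteq> U" and U: "U \<subseteq> isometry_group X"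
    unfolding nbhd_in_def isometry_topology_def by auto
  then obtain \<epsilon> where \<epsilon>: "\<epsilon> > 0" "G.mball (op_id X) \<epsilon> \<subseteq> V"
    unfolding G.openin_mtopology by blast
  obtain \<delta> where "\<delta> > 0" and \<delta>: "\<And>y. \<lbrakk>y \<in> unit_sphere X; vnorm X (vminus X x y) < \<delta>\<rbrakk> \<Longrightarrow>
      \<exists>T\<in>isometry_group X. T x = y \<and> op_norm X (op_minus X T (op_id X)) < \<epsilon>"
    using assms[OF \<epsilon>(1)] x by blast
  have "S.mball x \<delta> \<subseteq> (\<lambda>T. T x) ` U"
  proof
    fix y assume "y \<in> S.mball x \<delta>"
    then obtain T where T: "T \<in> isometry_group X" "T x = y" "op_norm X (op_minus X T (op_id X)) < \<epsilon>"
      using \<delta>[of y] by (auto split: if_splits)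
    then have "T \<in> G.mball (op_id X) \<epsilon>"
      using G.commute[of T "op_id X"] by simp
    then show "y \<in> (\<lambda>T. T x) ` U" using T \<epsilon> V by blast
  qed
  moreover have "(\<lambda>T. T x) ` U \<subseteq> unit_sphere X"
    using U x by (auto simp: unit_sphere_def isometry_group_def bounded_operatorsD(1) subset_iff)
  ultimately show "nbhd_in (sphere_topology X) x ((\<lambda>T. T x) ` U)"
    unfolding nbhd_in_def sphere_topology_def using x \<open>\<delta> > 0\<close>
    by (auto intro!: exI[of _ "S.mball x \<delta>"] simp del: S.in_mball simp: S.centre_in_mball_iff)
qed

lemma uniformly_micro_semitransitiveI:
  assumes "\<And>\<epsilon>. \<epsilon> > 0 \<Longrightarrow> \<exists>\<delta>>0. \<forall>x\<in>unit_sphere X. \<forall>y\<in>unit_sphere X. vnorm X (vminus X x y) < \<delta> \<longrightarrow>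
    (\<exists>T\<in>isometry_group X. T x = y \<and> op_norm X (op_minus X T (op_id X)) < \<epsilon>)"
  shows "uniformly_micro_semitransitive X"
proof -
  obtain \<beta> where \<beta>: "\<And>\<epsilon>. \<epsilon> > 0 \<Longrightarrow> \<beta> \<epsilon> > (0::real)" "\<And>\<epsilon> x y. \<lbrakk>\<epsilon> > 0; x \<in> unit_sphere X; y \<in> unit_sphere X;
      vnorm X (vminus X x y) < \<beta> \<epsilon>\<rbrakk> \<Longrightarrow>
      \<exists>T\<in>isometry_group X. T x = y \<and> op_norm X (op_minus X T (op_id X)) < \<epsilon>"
    using assms by metis
  \<comment> \<open>The point x of the sphere is essential: on the zero space the operator norm of
    an isometry is 0.\<close>
  have "op_norm X T = 1" if T: "T \<in> isometry_group X" and x: "x \<in> unit_sphere X" for T x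
  proof (rule antisym)
    show "op_norm X T \<le> 1" using T by (intro op_norm_le) (auto simp: isometry_group_def)
    show "1 \<le> op_norm X T"
      using norm_le_op_norm[of T x] T x by (auto simp: isometry_group_def unit_sphere_def)
  qed
  moreover have "isometry_group X \<subseteq> bounded_operators X" by (auto simp: isometry_group_def)
  ultimately have ex: "\<exists>T\<in>bounded_operators X. op_norm X T = 1 \<and> T x = y \<and> op_norm X (op_minus X T (op_id X)) < \<epsilon>"
    if "\<epsilon> > 0" "x \<in> unit_sphere X" "y \<in> unit_sphere X" "vnorm X (vminus X x y) < \<beta> \<epsilon>" for \<epsilon> x y
    using \<beta>(2)[OF that] that(2) by blast
  show ?thesis
    unfolding uniformly_micro_semitransitive_def
  proof (intro exI[of _ \<beta>] conjI ballI impI)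
    fix \<epsilon> :: real assume "\<epsilon> \<in> {0<..<2}"
    then have \<epsilon>: "\<epsilon> > 0" by simp
    then show "\<beta> \<epsilon> > 0" by (rule \<beta>(1))
    fix x y assume "x \<in> unit_sphere X" "y \<in> unit_sphere X" "vnorm X (vminus X x y) < \<beta> \<epsilon>"
    then show "\<exists>T\<in>bounded_operators X. op_norm X T = 1 \<and> T x = y \<and> op_norm X (op_minus X T (op_id X)) < \<epsilon>"
      by (rule ex[OF \<epsilon>])
  qed
qed

end

section \<open>Hilbertian norms\<close>

text \<open>The common laws of the identity on the reals and of complex conjugation, so that both
  scalar fields share one proof. \<open>mult_cj\<close> ties the conjugation to the norm.\<close>

locale scalar_conjugation =
  fixes cj :: "'k::real_normed_field \<Rightarrow> 'k"
  assumes cj_add: "cj (x + y) = cj x + cj y"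
    and cj_mult: "cj (x * y) = cj x * cj y"
    and cj_cj [simp]: "cj (cj x) = x"
    and cj_of_real [simp]: "cj (of_real r) = of_real r"
    and mult_cj: "x * cj x = of_real ((norm x)\<^sup>2)"
begin

lemma cj_zero [simp]: "cj 0 = 0" and cj_one [simp]: "cj 1 = 1"
  using cj_of_real[of 0] cj_of_real[of 1] by simp_all

lemma cj_minus: "cj (- x) = - cj x"
  using cj_add[of x "- x"] by (simp add: eq_neg_iff_add_eq_0 add.commute)

lemma cj_diff: "cj (x - y) = cj x - cj y"
  using cj_add[of x "- y"] by (simp add: cj_minus)

lemma cj_numeral [simp]: "cj (numeral n) = numeral n"
  using cj_of_real[of "numeral n"] by simp

lemma cj_power [simp]: "cj (x ^ n) = cj x ^ n"
  by (induction n) (simp_all add: cj_mult)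

lemma cj_divide: "cj (x / y) = cj x / cj y"
proof (cases "y = 0")
  case False
  then have "cj y \<noteq> 0" by (metis cj_cj cj_zero)
  moreover have "cj (x / y) * cj y = cj x" using False by (simp flip: cj_mult)
  ultimately show ?thesis by (simp add: field_simps)
qed simp

lemma norm_cj [simp]: "norm (cj x) = norm x"
proof (cases "x = 0")
  case False
  have "norm (x * cj x) = (norm x)\<^sup>2" by (simp add: mult_cj norm_power)
  then show ?thesis using False by (simp add: norm_mult power2_eq_square)
qed simp

end

locale hilbertian_space = normed_vector_space X + scalar_conjugation cj
  for X :: "('k::real_normed_field, 'v) normed_vs" and cj :: "'k \<Rightarrow> 'k" +
  fixes ip :: "'v \<Rightarrow> 'v \<Rightarrow> 'k"
  assumes inner_product: "inner_product_on cj X ip"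
    and ip_self: "x \<in> vcarrier X \<Longrightarrow> ip x x = of_real ((vnorm X x)\<^sup>2)"
begin

lemma ip_add_left:
  "\<lbrakk>x \<in> vcarrier X; y \<in> vcarrier X; z \<in> vcarrier X\<rbrakk> \<Longrightarrow> ip (vadd X x y) z = ip x z + ip y z"
  and ip_scale_left:
  "\<lbrakk>x \<in> vcarrier X; y \<in> vcarrier X\<rbrakk> \<Longrightarrow> ip (vscale X c x) y = c * ip x y"
  and ip_cj: "\<lbrakk>x \<in> vcarrier X; y \<in> vcarrier X\<rbrakk> \<Longrightarrow> cj (ip x y) = ip y x"
proof -
  note H = inner_product[unfolded inner_product_on_def]
  show "\<lbrakk>x \<in> vcarrier X; y \<in> vcarrier X; z \<in> vcarrier X\<rbrakk> \<Longrightarrow> ip (vadd X x y) z = ip x z + ip y z"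
    using H by blast
  show "\<lbrakk>x \<in> vcarrier X; y \<in> vcarrier X\<rbrakk> \<Longrightarrow> ip (vscale X c x) y = c * ip x y"
    using H by blast
  show "\<lbrakk>x \<in> vcarrier X; y \<in> vcarrier X\<rbrakk> \<Longrightarrow> cj (ip x y) = ip y x"
    using H by metis
qed

lemma ip_add_right:
  assumes "x \<in> vcarrier X" "y \<in> vcarrier X" "z \<in> vcarrier X"
  shows "ip z (vadd X x y) = ip z x + ip z y"
proof -
  have "ip z (vadd X x y) = cj (ip (vadd X x y) z)" using assms by (simp add: ip_cj)
  also have "\<dots> = cj (ip x z) + cj (ip y z)" using assms by (simp add: ip_add_left cj_add)
  finally show ?thesis using assms by (simp add: ip_cj)
qed

lemma ip_scale_right:
  assumes "x \<in> vcarrier X" "y \<in> vcarrier X"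
  shows "ip y (vscale X c x) = cj c * ip y x"
proof -
  have "ip y (vscale X c x) = cj (ip (vscale X c x) y)" using assms by (simp add: ip_cj)
  also have "\<dots> = cj c * cj (ip x y)" using assms by (simp add: ip_scale_left cj_mult)
  finally show ?thesis using assms by (simp add: ip_cj)
qed

lemmas ip_simps = ip_add_left ip_scale_left ip_add_right ip_scale_right

text \<open>Testing against all u turns identities between combinations of \<open>vadd\<close> and
  \<open>vscale\<close> into identities of scalars, which \<open>algebra_simps\<close> can
  settle.\<close>

lemma ip_eqI:
  assumes "x \<in> vcarrier X" "y \<in> vcarrier X" "\<And>u. u \<in> vcarrier X \<Longrightarrow> ip x u = ip y u"
  shows "x = y"
proof -
  have "ip (vminus X x y) (vminus X x y) = 0"
    using assms by (simp add: ip_simps vminus_def)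
  then show ?thesis using ip_self[of "vminus X x y"] assms by (simp add: norm_minus_eq_zero_iff)
qed

lemma Cauchy_Schwarz:
  assumes x: "x \<in> vcarrier X" and y: "y \<in> vcarrier X"
  shows "norm (ip x y) \<le> vnorm X x * vnorm X y"
proof (cases "vnorm X y = 0")
  case True
  then have "vscale X 0 y = y" using norm_eq_zeroD[OF y] scale_zero[OF y] by metis
  then have "ip x y = 0" using ip_scale_right[OF y x, of 0] by (simp del: scale_zero)
  then show ?thesis using x y by simp
next
  case False
  define a b c where "a = vnorm X x" and "b = vnorm X y" and "c = ip x y"
  have pos: "a \<ge> 0" "b > 0" using x y False by (simp_all add: a_def b_def less_le)
  \<comment> \<open>This is b^2 times the component of x orthogonal to y; the factor keeps the
    computation free of division.\<close>
  define z where "z = vadd X (vscale X (of_real (b\<^sup>2)) x) (vscale X (- c) y)"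
  have z: "z \<in> vcarrier X" using x y by (simp add: z_def)
  have yx: "ip y x = cj c" using x y by (simp add: c_def ip_cj)
  have self: "ip x x = of_real (a\<^sup>2)" "ip y y = of_real (b\<^sup>2)"
    using x y by (simp_all add: ip_self a_def b_def)
  have "ip z z = of_real (b\<^sup>2) * (of_real (b\<^sup>2) * of_real (a\<^sup>2) - c * cj c)"
    using x y unfolding z_def
    by (simp add: ip_simps self yx cj_minus cj_mult algebra_simps flip: c_def)
  also have "\<dots> = of_real (b\<^sup>2 * (b\<^sup>2 * a\<^sup>2 - (norm c)\<^sup>2))" by (simp add: mult_cj)
  finally have "of_real ((vnorm X z)\<^sup>2) = (of_real (b\<^sup>2 * (b\<^sup>2 * a\<^sup>2 - (norm c)\<^sup>2)) :: 'k)"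
    using ip_self[OF z] by simp
  then have "(vnorm X z)\<^sup>2 = b\<^sup>2 * (b\<^sup>2 * a\<^sup>2 - (norm c)\<^sup>2)" by (rule of_real_eq_iff[THEN iffD1])
  then have "0 \<le> b\<^sup>2 * (b\<^sup>2 * a\<^sup>2 - (norm c)\<^sup>2)" by (metis zero_le_power2)
  then have "(norm c)\<^sup>2 \<le> (a * b)\<^sup>2"
    using pos by (simp add: zero_le_mult_iff power_mult_distrib mult.commute)
  then show ?thesis using pos by (simp add: a_def b_def c_def power2_le_iff_abs_le)
qed

section \<open>A unitary map carrying one unit vector to another\<close>

definition rot_coeff :: "'v \<Rightarrow> 'v \<Rightarrow> 'v \<Rightarrow> 'k" where
  "rot_coeff x y v = (ip v x + ip v y) / (1 + ip x y)"

text \<open>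
  For unit vectors with \<open>1 + \<langle>x,y\<rangle> \<noteq> 0\<close> this is the product of the unitary maps
  \<open>v \<mapsto> 2\<langle>v,x\<rangle>x - v\<close> and \<open>v \<mapsto> \<langle>v,x+y\<rangle>/(1+\<langle>x,y\<rangle>) (x+y) - v\<close>.  In a complex space the second one
  sends \<open>x\<close> to \<open>y\<close> even when \<open>\<langle>x,y\<rangle>\<close> is not real, unlike the reflection in \<open>x+y\<close>.
\<close>

definition rot :: "'v \<Rightarrow> 'v \<Rightarrow> 'v \<Rightarrow> 'v" where
  "rot x y v = vadd X v (vadd X (vscale X (- rot_coeff x y v) x)
     (vscale X (2 * ip v x - rot_coeff x y v) y))"

lemma rot_closed [simp]:
  "\<lbrakk>x \<in> vcarrier X; y \<in> vcarrier X; v \<in> vcarrier X\<rbrakk> \<Longrightarrow> rot x y v \<in> vcarrier X"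
  by (simp add: rot_def)

lemma ip_rot_left:
  assumes "x \<in> vcarrier X" "y \<in> vcarrier X" "v \<in> vcarrier X" "u \<in> vcarrier X"
  shows "ip (rot x y v) u =
    ip v u - rot_coeff x y v * ip x u + (2 * ip v x - rot_coeff x y v) * ip y u"
  using assms by (simp add: rot_def ip_simps)

lemma rot_add:
  assumes "x \<in> vcarrier X" "y \<in> vcarrier X" "v \<in> vcarrier X" "w \<in> vcarrier X"
  shows "rot x y (vadd X v w) = vadd X (rot x y v) (rot x y w)"
  by (rule ip_eqI)
    (use assms in \<open>simp_all add: ip_rot_left ip_simps rot_coeff_def add_divide_distrib algebra_simps\<close>)

lemma rot_scale:
  assumes "x \<in> vcarrier X" "y \<in> vcarrier X" "v \<in> vcarrier X"
  shows "rot x y (vscale X c v) = vscale X c (rot x y v)"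
  by (rule ip_eqI)
    (use assms in \<open>simp_all add: ip_rot_left ip_simps rot_coeff_def add_divide_distrib algebra_simps\<close>)

lemma ip_sphere: "x \<in> unit_sphere X \<Longrightarrow> ip x x = 1"
  by (simp add: unit_sphere_def ip_self)

context
  fixes x y
  assumes xy [simp]: "x \<in> vcarrier X" "y \<in> vcarrier X" and ip_xy [simp]: "ip x x = 1" "ip y y = 1"
    and nz: "1 + ip x y \<noteq> 0"
begin

lemma rot_apply: "rot x y x = y"
proof (rule ip_eqI)
  have "rot_coeff x y x = 1" using nz by (simp add: rot_coeff_def)
  then show "ip (rot x y x) u = ip y u" if "u \<in> vcarrier X" for u
    using that by (simp add: ip_rot_left)
qed simp_all

lemma nz': "1 + ip y x \<noteq> 0"
  using nz ip_cj[of x y] cj_add[of 1 "ip x y"] by (metis cj_cj cj_one cj_zero xy)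

lemma rot_coeff_eq: "rot_coeff x y v * (1 + ip x y) = ip v x + ip v y"
  using nz by (simp add: rot_coeff_def)

lemma rot_rot: 
  assumes v: "v \<in> vcarrier X"
  shows "rot y x (rot x y v) = v"
proof (rule ip_eqI)
  define e f c c' k where "e = ip v x" "f = ip v y" "c = ip x y" "c' = ip y x" "k = rot_coeff x y v"
  note defs = this
  have k: "k * (1 + c) = e + f" using rot_coeff_eq by (simp add: defs)
  have w: "ip (rot x y v) x = e - k + (2 * e - k) * c'" "ip (rot x y v) y = f - k * c + (2 * e - k)"
    using v by (simp_all add: ip_rot_left defs)
  have "ip (rot x y v) y + ip (rot x y v) x = (2 * e - k) * (1 + c') + (e + f - k * (1 + c))"
    unfolding w by (simp add: algebra_simps)
  \<comment> \<open>Swapping x and y turns the coefficient k into 2 e - k. This cancels the y part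
    of \<open>rot x y v\<close>; the x part left over is a multiple of e + f - k (1 + c), which is
    0.\<close>
  then have k': "rot_coeff y x (rot x y v) = 2 * e - k"
    using nz' k by (simp add: rot_coeff_def flip: defs(4))
  fix u assume u: "u \<in> vcarrier X"
  have "ip (rot y x (rot x y v)) u = ip v u + 2 * (e + f - k * (1 + c)) * ip x u"
    using u v by (subst ip_rot_left) (simp_all add: w k' ip_rot_left flip: defs, simp add: algebra_simps)
  then show "ip (rot y x (rot x y v)) u = ip v u" using k by simp
qed (use v in simp_all)

text \<open>The conjugate of 1 + <y,x> is 1 + <x,y>, so the adjoint is the map with x and y swapped.
  By \<open>rot_rot\<close> that is also the inverse, and norm preservation follows without
  expanding a quadratic form.\<close>

lemma ip_rot_adjoint:
  assumes v: "v \<in> vcarrier X" and u: "u \<in> vcarrier X"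
  shows "ip (rot x y v) u = ip v (rot y x u)"
proof -
  have "ip v (rot y x u) = cj (ip (rot y x u) v)" using u v by (simp add: ip_cj)
  also have "\<dots> = ip v u - (ip y u + ip x u) / (1 + ip x y) * ip v y
      + (2 * ip y u - (ip y u + ip x u) / (1 + ip x y)) * ip v x"
    using u v by (simp add: ip_rot_left rot_coeff_def cj_add cj_diff cj_mult cj_divide ip_cj)
  also have "\<dots> = ip (rot x y v) u"
    using u v by (simp add: ip_rot_left rot_coeff_def add_divide_distrib algebra_simps)
  finally show ?thesis ..
qed

lemma norm_rot:
  assumes v: "v \<in> vcarrier X"
  shows "vnorm X (rot x y v) = vnorm X v"
proof -
  have "ip (rot x y v) (rot x y v) = ip v v" using v by (simp add: ip_rot_adjoint rot_rot)
  then have "(vnorm X (rot x y v))\<^sup>2 = (vnorm X v)\<^sup>2" using v by (simp add: ip_self flip: of_real_power)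
  then show ?thesis using v by simp
qed

end

text \<open>Both bounds rest on <x,y> - 1 = <x - y, y>. They keep the denominator of
  \<open>rot_coeff\<close> away from 0.\<close>

lemma one_add_ip_ge:
  assumes x: "x \<in> unit_sphere X" and y: "y \<in> unit_sphere X"
  shows "norm (ip x y - 1) \<le> vnorm X (vminus X x y)" "2 - vnorm X (vminus X x y) \<le> norm (1 + ip x y)"
proof -
  have c: "x \<in> vcarrier X" "y \<in> vcarrier X" "ip y y = 1" "vnorm X y = 1"
    using x y ip_sphere[OF y] by (simp_all add: unit_sphere_def)
  then have "norm (ip x y - 1) = norm (ip (vminus X x y) y)" by (simp add: vminus_def ip_simps)
  also have "\<dots> \<le> vnorm X (vminus X x y)" using Cauchy_Schwarz[of "vminus X x y" y] c by simp
  finally show 1: "norm (ip x y - 1) \<le> vnorm X (vminus X x y)" .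
  have "norm (2::'k) \<le> norm (1 + ip x y) + norm (ip x y - 1)"
    using norm_triangle_ineq4[of "1 + ip x y" "ip x y - 1"] by simp
  then show "2 - vnorm X (vminus X x y) \<le> norm (1 + ip x y)" using 1 by simp
qed

text \<open>The displacement of v is 2 (e - k) y - k (x - y), where e = <v,x> and k =
  \<open>rot_coeff x y v\<close>. The constant 6 is 4 for the first term plus 2 for the
  second.\<close>

lemma norm_rot_minus_id:
  assumes x: "x \<in> unit_sphere X" and y: "y \<in> unit_sphere X" and v: "v \<in> vcarrier X"
    and d: "vnorm X (vminus X x y) \<le> 1"
  shows "vnorm X (vminus X (rot x y v) v) \<le> 6 * vnorm X (vminus X x y) * vnorm X v"
proof -
  define \<delta> e f c k n where "\<delta> = vnorm X (vminus X x y)" "e = ip v x" "f = ip v y" "c = ip x y"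
    "k = rot_coeff x y v" "n = vnorm X v"
  note defs = this
  have xy: "x \<in> vcarrier X" "y \<in> vcarrier X" "vnorm X x = 1" "vnorm X y = 1"
    using x y by (simp_all add: unit_sphere_def)
  have n0: "n \<ge> 0" "\<delta> \<ge> 0" using v xy by (simp_all add: defs)
  have c: "norm (1 + c) \<ge> 1" "norm (c - 1) \<le> \<delta>" using one_add_ip_ge[OF x y] d by (auto simp: defs)
  have e: "norm e \<le> n" "norm f \<le> n" using Cauchy_Schwarz[OF v xy(1)] Cauchy_Schwarz[OF v xy(2)] xy unfolding defs by simp_all
  have ef: "norm (e - f) \<le> n * \<delta>"
  proof -
    have "e - f = ip v (vminus X x y)" using xy v by (simp add: defs vminus_def ip_simps cj_minus)
    then show ?thesis using Cauchy_Schwarz[OF v, of "vminus X x y"] xy by (simp add: defs)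
  qed
  have nz: "1 + c \<noteq> 0" using c by auto
  have le: "norm (z / (1 + c)) \<le> norm z" for z
    using c mult_left_mono[of 1 "norm (1 + c)" "norm z"] nz by (simp add: norm_divide divide_le_eq)
  have k: "k = (e + f) / (1 + c)" by (simp add: defs rot_coeff_def)
  have "norm k \<le> norm (e + f)" unfolding k by (rule le)
  also have "\<dots> \<le> 2 * n" using norm_triangle_ineq[of e f] e by simp
  finally have nk: "norm k \<le> 2 * n" .
  \<comment> \<open>When x and y are close, c is near 1 and f near e, so k is near e; the identity
    separates these two sources of error.\<close>
  have "2 * e - 2 * k = 2 * (e * (c - 1) + (e - f)) / (1 + c)"
    using nz by (simp add: k field_simps)
  then have "norm (2 * e - 2 * k) \<le> norm (2 * (e * (c - 1) + (e - f)))" using le by simp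
  also have "\<dots> \<le> 2 * (norm e * norm (c - 1) + norm (e - f))"
    using norm_triangle_ineq[of "e * (c - 1)" "e - f"] unfolding norm_mult norm_numeral by (rule mult_left_mono) simp
  also have "\<dots> \<le> 2 * (n * \<delta> + n * \<delta>)"
    by (rule mult_left_mono[OF add_mono[OF mult_mono[OF e(1) c(2) n0(1) norm_ge_zero] ef] zero_le_numeral])
  finally have n2: "norm (2 * e - 2 * k) \<le> 4 * (n * \<delta>)" by (simp add: mult.commute)
  have "vminus X (rot x y v) v = vadd X (vscale X (2 * e - 2 * k) y) (vscale X (- k) (vminus X x y))"
    by (rule ip_eqI) (use xy v in \<open>simp_all add: ip_simps vminus_def ip_rot_left flip: defs\<close>,
       simp add: algebra_simps)
  then have "vnorm X (vminus X (rot x y v) v) \<le> norm (2 * e - 2 * k) + norm k * \<delta>"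
    using norm_triangle[of "vscale X (2 * e - 2 * k) y" "vscale X (- k) (vminus X x y)"] xy
    by (simp add: norm_scale defs)
  also have "\<dots> \<le> 4 * (n * \<delta>) + (2 * n) * \<delta>"
    using n2 nk n0 by (intro add_mono mult_right_mono) auto
  finally show ?thesis by (simp add: defs algebra_simps)
qed

lemma exists_isometry:
  assumes "\<epsilon> > 0"
  shows "\<exists>\<delta>>0. \<forall>x\<in>unit_sphere X. \<forall>y\<in>unit_sphere X. vnorm X (vminus X x y) < \<delta> \<longrightarrow>
    (\<exists>T\<in>isometry_group X. T x = y \<and> op_norm X (op_minus X T (op_id X)) < \<epsilon>)"
proof (intro exI[of _ "min 1 (\<epsilon> / 7)"] conjI ballI impI)
  \<comment> \<open>The bound 1 is the hypothesis of \<open>norm_rot_minus_id\<close> and keeps 1 +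
    <x,y> nonzero; \<epsilon> / 7 makes 6 times the distance smaller than \<epsilon>.\<close>
  show "min 1 (\<epsilon> / 7) > 0" using assms by simp
  fix x y assume x: "x \<in> unit_sphere X" and y: "y \<in> unit_sphere X"
    and d: "vnorm X (vminus X x y) < min 1 (\<epsilon> / 7)"
  have xy: "x \<in> vcarrier X" "y \<in> vcarrier X" using x y by (simp_all add: unit_sphere_def)
  have nz: "1 + ip x y \<noteq> 0" using one_add_ip_ge(2)[OF x y] d by auto
  note r = xy ip_sphere[OF x] ip_sphere[OF y]
  note r' = xy(2,1) ip_sphere[OF y] ip_sphere[OF x]
  have nz': "1 + ip y x \<noteq> 0" by (rule nz'[OF r nz])
  define T where "T = (\<lambda>v\<in>vcarrier X. rot x y v)"
  have "T \<in> bounded_operators X"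
    unfolding bounded_operators_def T_def
    using norm_rot[OF r nz] by (auto simp: xy rot_add rot_scale intro!: exI[of _ 1])
  moreover have "T ` vcarrier X = vcarrier X"
  proof
    show "vcarrier X \<subseteq> T ` vcarrier X"
    proof
      fix v assume v: "v \<in> vcarrier X"
      then show "v \<in> T ` vcarrier X"
        using rot_rot[OF r' nz' v] by (intro image_eqI[of _ _ "rot y x v"]) (simp_all add: T_def xy)
    qed
  qed (auto simp: T_def xy)
  ultimately have T: "T \<in> isometry_group X"
    using norm_rot[OF r nz] by (simp add: isometry_group_def T_def)
  have "op_norm X (op_minus X T (op_id X)) \<le> 6 * vnorm X (vminus X x y)"
  proof (rule op_norm_le)
    fix v assume v: "v \<in> vcarrier X" "vnorm X v \<le> 1"
    have "vnorm X (op_minus X T (op_id X) v) = vnorm X (vminus X (rot x y v) v)"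
      using v by (simp add: op_minus_def op_id_def T_def)
    also have "\<dots> \<le> 6 * vnorm X (vminus X x y) * vnorm X v"
      using d by (intro norm_rot_minus_id x y v) simp
    also have "\<dots> \<le> 6 * vnorm X (vminus X x y) * 1" using v xy by (intro mult_left_mono) auto
    finally show "vnorm X (op_minus X T (op_id X) v) \<le> 6 * vnorm X (vminus X x y)" by simp
  qed
  also have "\<dots> < \<epsilon>" using d assms by auto
  finally have "op_norm X (op_minus X T (op_id X)) < \<epsilon>" .
  moreover have "T x = y" using rot_apply[OF r nz] by (simp add: T_def xy)
  ultimately show "\<exists>T\<in>isometry_group X. T x = y \<and> op_norm X (op_minus X T (op_id X)) < \<epsilon>"
    using T by blast
qed

end

lemma (in normed_vector_space) hilbertian_imp_transitive:
  fixes cj :: "'k \<Rightarrow> 'k"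
  assumes "scalar_conjugation cj" "hilbertian_norm cj X"
  shows "uniformly_micro_semitransitive X" "micro_transitive X"
proof -
  obtain ip where ip: "inner_product_on cj X ip" "\<forall>x\<in>vcarrier X. ip x x = of_real ((vnorm X x)\<^sup>2)"
    using assms(2) unfolding hilbertian_norm_def by blast
  interpret scalar_conjugation cj by (rule assms)
  interpret hilbertian_space X cj ip
    by unfold_locales (use ip in auto)
  show "uniformly_micro_semitransitive X" "micro_transitive X"
    by (rule uniformly_micro_semitransitiveI[OF exists_isometry] micro_transitiveI[OF exists_isometry], assumption)+
qed

lemma (in normed_vector_space) one_dimensional_imp_hilbertian:
  fixes cj :: "'k \<Rightarrow> 'k"
  assumes "scalar_conjugation cj" "one_dimensional X"
  shows "hilbertian_norm cj X"
proof -
  interpret scalar_conjugation cj by (rule assms)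
  obtain v where v: "v \<in> vcarrier X" "v \<noteq> vzero X" and all: "vcarrier X = range (\<lambda>c. vscale X c v)"
    using assms(2) unfolding one_dimensional_def by blast
  have nv: "vnorm X v \<noteq> 0" using v norm_eq_zeroD by blast
  have inj: "c = d" if "vscale X c v = vscale X d v" for c d
  proof -
    have "vscale X (c - d) v = vminus X (vscale X c v) (vscale X d v)"
      using v add_scale[of v c "- d"] by (simp add: vminus_def scale_scale)
    also have "\<dots> = vzero X" using that v by simp
    finally have "vnorm X (vscale X (c - d) v) = 0" by simp
    then show ?thesis using v nv by (simp add: norm_scale)
  qed
  define co where "co x = (THE c. x = vscale X c v)" for x
  have co [simp]: "co (vscale X c v) = c" for c
    unfolding co_def using inj by blast
  \<comment> \<open>The inner product of the coordinates with respect to v, scaled so that v keeps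
    its norm.\<close>
  define ip where "ip x y = co x * cj (co y) * of_real ((vnorm X v)\<^sup>2)" for x y
  have self: "ip (vscale X c v) (vscale X c v) = of_real ((norm c * vnorm X v)\<^sup>2)" for c
    by (simp add: ip_def mult_cj power_mult_distrib)
  have "inner_product_on cj X ip"
    unfolding inner_product_on_def all
  proof (intro conjI ballI allI impI; elim rangeE; simp only:)
    fix c assume "vscale X c v \<noteq> vzero X"
    then have "c \<noteq> 0" using v by auto
    then show "\<exists>r>0. ip (vscale X c v) (vscale X c v) = of_real r"
      using nv by (intro exI[of _ "(norm c * vnorm X v)\<^sup>2"]) (simp only: self, simp)
  qed (use v in \<open>simp_all add: ip_def scale_scale cj_mult mult.commute algebra_simps flip: add_scale\<close>)
  moreover have "ip x x = of_real ((vnorm X x)\<^sup>2)" if x: "x \<in> vcarrier X" for x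
  proof -
    obtain c where "x = vscale X c v" using x unfolding all by blast
    then show ?thesis using v by (simp only: self norm_scale)
  qed
  ultimately show ?thesis unfolding hilbertian_norm_def by blast
qed

section \<open>Complemented copies of the two-dimensional sequence space\<close>

lemma powr_convex_combination:
  fixes x y :: real
  assumes "1 \<le> r" "0 \<le> x" "0 \<le> y" "0 \<le> l" "0 \<le> m" "l + m = 1"
  shows "(l * x + m * y) powr r \<le> l * x powr r + m * y powr r"
proof -
  \<comment> \<open>\<open>powr_convex\<close> concerns the open half-line; if x or y is 0, the
    claim reduces to this inequality for a weight.\<close>
  have *: "k powr r \<le> k" if "0 \<le> k" "k \<le> 1" for k :: real
    using that assms(1) powr_le_one_le[of k r] by (cases "k = 0") auto
  show ?thesis
  proof (cases "x = 0 \<or> y = 0")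
    case True
    then show ?thesis
      using assms *[of l] *[of m] by (auto simp: powr_mult intro!: mult_right_mono)
  next
    case False
    have "convex_on {0<..} (\<lambda>x. x powr r)" by (rule powr_convex[OF assms(1)])
    from convex_onD[OF this, of m x y] show ?thesis using assms False
      by (auto simp: eq_diff_eq[symmetric])
  qed
qed

lemma powr_mean_le:
  fixes x y :: real
  assumes "1 \<le> r" "0 \<le> x" "0 \<le> y"
  shows "((x + y) / 2) powr r \<le> (x powr r + y powr r) / 2"
  using powr_convex_combination[OF assms, of "1/2" "1/2"] by (simp add: field_simps)

lemma Bernoulli_powr:
  fixes t :: real
  assumes "1 \<le> r" "0 \<le> t"
  shows "1 + r * (t - 1) \<le> t powr r"
proof (cases "t = 0")
  case False
  have "(\<lambda>x. x powr r) t - (\<lambda>x. x powr r) 1 \<ge> r * (t - 1)"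
  proof (rule convex_on_imp_above_tangent)
    show "convex_on {0<..} (\<lambda>x. x powr r)" by (rule powr_convex[OF assms(1)])
    show "((\<lambda>x. x powr r) has_real_derivative r) (at 1 within {0<..})"
      by (auto intro!: derivative_eq_intros)
  qed (use assms False in \<open>auto simp: interior_open\<close>)
  then show ?thesis by simp
qed (use assms in simp)

text \<open>u is the midpoint of u + w and u - w. This convexity bound stands in for a first-order
  expansion of the norm.\<close>

lemma norm_add_powr_ge:
  fixes u w :: "'k::real_normed_vector"
  assumes "1 \<le> r"
  shows "2 * norm u powr r \<le> norm (u + w) powr r + norm (u - w) powr r"
proof -
  have "norm (2 *\<^sub>R u) \<le> norm (u + w) + norm (u - w)"
    using norm_triangle_ineq[of "u + w" "u - w"] by (simp add: scaleR_2)
  then have "norm u powr r \<le> ((norm (u + w) + norm (u - w)) / 2) powr r"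
    using assms by (intro powr_mono2) auto
  then show ?thesis using powr_mean_le[OF assms, of "norm (u + w)" "norm (u - w)"] by simp
qed

lemma parallelogram_identity:
  fixes u w :: "'k::real_inner"
  shows "(norm (u + w))\<^sup>2 + (norm (u - w))\<^sup>2 = 2 * ((norm u)\<^sup>2 + (norm w)\<^sup>2)"
  by (simp add: power2_norm_eq_inner inner_add inner_diff inner_commute)

lemma sq_powr_half: "0 \<le> (x::real) \<Longrightarrow> (x\<^sup>2) powr (r / 2) = x powr r"
  by (cases "x = 0") (simp_all add: powr_powr flip: powr_numeral)

text \<open>The power mean of exponent r dominates the one of exponent 2, and the parallelogram law
  evaluates the latter at the norms of u + w and u - w.\<close>

lemma parallelogram_powr_ge:
  fixes u w :: "'k::real_inner"
  assumes "2 \<le> r"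
  shows "2 * ((norm u)\<^sup>2 + (norm w)\<^sup>2) powr (r / 2) \<le> norm (u + w) powr r + norm (u - w) powr r"
proof -
  have eq: "((norm (u + w))\<^sup>2 + (norm (u - w))\<^sup>2) / 2 = (norm u)\<^sup>2 + (norm w)\<^sup>2"
    using parallelogram_identity[of u w] by simp
  have "(((norm (u + w))\<^sup>2 + (norm (u - w))\<^sup>2) / 2) powr (r / 2) \<le> (norm (u + w) powr r + norm (u - w) powr r) / 2"
    using powr_mean_le[of "r / 2" "(norm (u + w))\<^sup>2" "(norm (u - w))\<^sup>2"] assms
    by (simp only: sq_powr_half norm_ge_zero) simp
  then show ?thesis unfolding eq by simp
qed

text \<open>For r \<le> 2 the comparison of power means is reversed: convexity is used with exponent
  2 / r, on the r-th powers.\<close>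

lemma parallelogram_powr_le:
  fixes u w :: "'k::real_inner"
  assumes "1 \<le> r" "r \<le> 2"
  shows "norm (u + w) powr r + norm (u - w) powr r \<le> 2 * ((norm u)\<^sup>2 + (norm w)\<^sup>2) powr (r / 2)"
proof -
  define A where "A = (norm (u + w) powr r + norm (u - w) powr r) / 2"
  have sq: "(x powr r) powr (2 / r) = x\<^sup>2" if "0 \<le> x" for x :: real
    using that assms by (cases "x = 0") (simp_all add: powr_powr)
  have "A powr (2 / r) \<le> (norm u)\<^sup>2 + (norm w)\<^sup>2"
    using powr_mean_le[of "2 / r" "norm (u + w) powr r" "norm (u - w) powr r"] assms
    by (simp add: sq parallelogram_identity A_def)
  then have "(A powr (2 / r)) powr (r / 2) \<le> ((norm u)\<^sup>2 + (norm w)\<^sup>2) powr (r / 2)"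
    using assms by (intro powr_mono2) auto
  moreover have "(A powr (2 / r)) powr (r / 2) = A"
    using assms by (simp add: powr_powr A_def)
  ultimately show ?thesis by (simp add: A_def)
qed

text \<open>The halved argument here and the factor 1/4 in \<open>exists_powr_less_sq\<close> come
  from the lower bound 1/2 on the b-coordinate of the witness v in
  \<open>not_locally_dominated_lr\<close>.\<close>

lemma exists_sq_less_powr:
  fixes r :: real
  assumes "1 \<le> r" "r < 2"
  obtains s where "0 < s" "s < 1" "s\<^sup>2 < (s / 2) powr r"
proof
  \<comment> \<open>Chosen so that s powr (2 - r) is half of 2 powr (- r), the threshold at which
    s^2 and (s / 2) powr r agree.\<close>
  define s where "s = (2::real) powr (- (r + 1) / (2 - r))"
  show "0 < s" by (simp add: s_def)
  show "s < 1" using assms by (simp add: s_def powr_less_one divide_neg_pos)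
  have "s\<^sup>2 = s powr r * s powr (2 - r)" using \<open>0 < s\<close> by (simp flip: powr_add)
  also have "s powr (2 - r) = 2 powr (- (r + 1))" using assms by (simp add: s_def powr_powr)
  also have "s powr r * 2 powr (- (r + 1)) < s powr r * 2 powr (- r)"
    using \<open>0 < s\<close> by (intro mult_strict_left_mono powr_less_mono) auto
  also have "\<dots> = (s / 2) powr r" by (simp add: powr_divide powr_minus_divide)
  finally show "s\<^sup>2 < (s / 2) powr r" .
qed

lemma exists_powr_less_sq:
  fixes r :: real
  assumes "2 < r"
  obtains s where "0 < s" "s < 1" "s powr r < s\<^sup>2 / 4"
proof
  \<comment> \<open>Makes s powr (r - 2) equal to 1/8, below the required 1/4.\<close>
  define s where "s = (2::real) powr (- 3 / (r - 2))"
  show "0 < s" by (simp add: s_def)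
  show "s < 1" using assms by (simp add: s_def powr_less_one divide_neg_pos)
  have "s powr r = s\<^sup>2 * s powr (r - 2)" using \<open>0 < s\<close> by (simp flip: powr_add powr_numeral)
  also have "s powr (r - 2) = 2 powr (- 3 / (r - 2) * (r - 2))" unfolding s_def powr_powr ..
  also have "- 3 / (r - 2) * (r - 2) = - 3" using assms by (simp add: divide_simps)
  also have "s\<^sup>2 * 2 powr (- 3) < s\<^sup>2 / 4"
    using \<open>0 < s\<close> by (simp add: powr_minus_divide)
  finally show "s powr r < s\<^sup>2 / 4" .
qed

text \<open>
  The hypotheses say that the span of \<open>a\<close> and \<open>b\<close> is an isometric copy of the two-dimensional
  space \<open>\<ell>\<^sub>r\<close> and that \<open>(\<phi>, \<psi>)\<close> is a projection of norm one onto it.  In the proof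
  the functions \<open>\<tau> \<mapsto> \<parallel>x + \<tau> w\<parallel>\<^sup>r + \<parallel>x - \<tau> w\<parallel>\<^sup>r - 2\<close> are compared at \<open>x = a\<close>, where they have order
  \<open>\<tau>\<^sup>r\<close>, and at a unit vector \<open>y = \<alpha> a + \<beta> b\<close> near \<open>a\<close>, where they have order \<open>\<tau>\<^sup>2\<close>.
\<close>

lemma not_locally_dominated_lr:
  fixes X :: "('k::{real_normed_field,euclidean_space}, 'v) normed_vs" and r :: real
  assumes X: "normed_vector_space X" and r: "1 \<le> r" "r \<noteq> 2"
    and ab: "a \<in> vcarrier X" "b \<in> vcarrier X"
    and norm_ab: "\<And>c d. vnorm X (vadd X (vscale X c a) (vscale X d b)) powr r = norm c powr r + norm d powr r"
    and \<phi>: "\<And>x y t. \<lbrakk>x \<in> vcarrier X; y \<in> vcarrier X\<rbrakk> \<Longrightarrow> \<phi> (vadd X x (vscale X t y)) = \<phi> x + t * \<phi> y"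
    and \<psi>: "\<And>x y t. \<lbrakk>x \<in> vcarrier X; y \<in> vcarrier X\<rbrakk> \<Longrightarrow> \<psi> (vadd X x (vscale X t y)) = \<psi> x + t * \<psi> y"
    and \<phi>\<psi>: "\<And>x. x \<in> vcarrier X \<Longrightarrow> norm (\<phi> x) powr r + norm (\<psi> x) powr r \<le> vnorm X x powr r"
    and vals: "\<phi> a = 1" "\<phi> b = 0" "\<psi> a = 0" "\<psi> b = (1::'k)"
  shows "\<not> locally_dominated X a"
proof
  interpret normed_vector_space X by (rule X)
  assume "locally_dominated X a"
  then obtain \<delta> where "\<delta> > 0" and dom: "\<And>y. \<lbrakk>y \<in> unit_sphere X; vnorm X (vminus X a y) < \<delta>\<rbrakk> \<Longrightarrow>
      dominated X a y \<and> dominated X y a"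
    unfolding locally_dominated_def by blast
  \<comment> \<open>The distance from a to y will be at most (1 - \<alpha>) + \<beta> \<le> 2
    \<beta>; \<alpha> is then chosen to make y a unit vector.\<close>
  define \<beta> where "\<beta> = min (1/2) (\<delta> / 4)"
  have \<beta>: "0 < \<beta>" "\<beta> < 1" "2 * \<beta> < \<delta>" using \<open>\<delta> > 0\<close> by (auto simp: \<beta>_def)
  define \<alpha> where "\<alpha> = (1 - \<beta> powr r) powr (1 / r)"
  have \<beta>r: "\<beta> powr r \<le> \<beta>" using \<beta> r by (intro powr_le_one_le) auto
  have \<alpha>r: "\<alpha> powr r = 1 - \<beta> powr r" using \<beta> \<beta>r r by (simp add: \<alpha>_def powr_powr)
  have \<alpha>: "0 \<le> \<alpha>" "\<alpha> \<le> 1" using \<beta> \<beta>r r by (auto simp: \<alpha>_def intro!: powr_le1)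
  have "\<alpha> powr r \<le> \<alpha>" using \<alpha> r by (cases "\<alpha> = 0") (auto intro!: powr_le_one_le)
  then have \<alpha>\<beta>: "1 - \<alpha> \<le> \<beta>" using \<alpha>r \<beta>r by simp
  define L where "L c d = vadd X (vscale X c a) (vscale X d b)" for c d
  have L [simp]: "L c d \<in> vcarrier X" for c d using ab by (simp add: L_def)
  have norm_L: "vnorm X (L c d) powr r = norm c powr r + norm d powr r" for c d
    by (simp add: L_def norm_ab)
  have norm_eq_1: "vnorm X x = 1" if "x \<in> vcarrier X" "vnorm X x powr r = 1" for x
    using that r norm_nonneg[OF that(1)] powr_inj[of "vnorm X x" 1]
    by (smt (verit, best) powr_0 powr_eq_one_iff_gen powr_zero_eq_one)
  have La: "a = L 1 0" and Lb: "b = L 0 1" using ab by (simp_all add: L_def)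
  have norm_a: "vnorm X a = 1" using norm_eq_1[OF ab(1)] norm_L[of 1 0] by (simp flip: La)
  have norm_b: "vnorm X b = 1" using norm_eq_1[OF ab(2)] norm_L[of 0 1] by (simp flip: Lb)
  have a: "a \<in> unit_sphere X" using ab norm_a by (simp add: unit_sphere_def)
  define y where "y = L (of_real \<alpha>) (of_real \<beta>)"
  have y: "y \<in> vcarrier X" by (simp add: y_def)
  have "vnorm X y powr r = 1" using \<alpha> \<beta> by (simp add: y_def norm_L \<alpha>r)
  then have yS: "y \<in> unit_sphere X" using norm_eq_1 y by (simp add: unit_sphere_def)
  have "vminus X a y = vadd X (vscale X (1 - of_real \<alpha>) a) (vscale X (- of_real \<beta>) b)"
  proof -
    have "vscale X (1 - of_real \<alpha>) a = vadd X a (vscale X (- of_real \<alpha>) a)"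
      using add_scale[of a 1 "- of_real \<alpha>"] ab by simp
    then show ?thesis
      using ab by (simp add: y_def L_def vminus_def scale_add scale_scale add_assoc)
  qed
  then have "vnorm X (vminus X a y) \<le> norm (1 - of_real \<alpha> :: 'k) * 1 + norm (- of_real \<beta> :: 'k) * 1"
    using norm_triangle[of "vscale X (1 - of_real \<alpha>) a" "vscale X (- of_real \<beta>) b"] ab norm_a norm_b
    by (simp add: norm_scale)
  also have "\<dots> = (1 - \<alpha>) + \<beta>"
    using \<alpha> \<beta> norm_of_real[of "1 - \<alpha>", where 'a='k] by simp
  also have "\<dots> < \<delta>" using \<alpha>\<beta> \<beta> by simp
  finally have dom: "dominated X a y" "dominated X y a" using dom yS by auto
  have ya: "vadd X y (vscale X t b) = L (of_real \<alpha>) (of_real \<beta> + t)" for t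
    using ab by (simp add: y_def L_def add_assoc add_scale)
  have aa: "vadd X a (vscale X t b) = L 1 t" for t
    using ab by (simp add: L_def)
  \<comment> \<open>Here closeness to the identity enters: \<psi> (v - b) has norm at most ||v - b||
    \<le> 1/2, while \<psi> b = 1, so the b-coordinate of v stays away from 0.\<close>
  have \<psi>v: "norm (\<psi> v) \<ge> 1 / 2" if v: "v \<in> vcarrier X" "vnorm X (vminus X v b) \<le> 1 / 2" for v
  proof -
    have "\<psi> (vminus X v b) = \<psi> v - 1" using v ab \<psi> vals by (simp add: vminus_def)
    then have "norm (\<psi> v - 1) powr r \<le> vnorm X (vminus X v b) powr r"
      using \<phi>\<psi>[of "vminus X v b"] v ab by (smt (verit, best) minus_closed powr_ge_zero)
    then have "norm (\<psi> v - 1) \<le> vnorm X (vminus X v b)"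
      using r v ab powr_less_mono2[of r "vnorm X (vminus X v b)" "norm (\<psi> v - 1)"]
      by (smt (verit, best) minus_closed norm_nonneg)
    then show ?thesis using v norm_triangle_ineq2[of 1 "1 - \<psi> v"] by (simp add: norm_minus_commute)
  qed
  have "\<phi> (vzero X) = 0" "\<psi> (vzero X) = 0"
    using \<phi>[of "vzero X" "vzero X" 1] \<psi>[of "vzero X" "vzero X" 1] by simp_all
  then have "\<phi> (vscale X c a) = c" "\<psi> (vscale X c a) = 0" for c
    using \<phi>[of "vzero X" a c] \<psi>[of "vzero X" a c] ab vals by simp_all
  then have \<psi>y: "\<phi> y = of_real \<alpha>" "\<psi> y = of_real \<beta>"
    using \<phi>[of "vscale X (of_real \<alpha>) a" b "of_real \<beta>"] \<psi>[of "vscale X (of_real \<alpha>) a" b "of_real \<beta>"] ab vals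
    by (simp_all add: y_def L_def)
  consider "r < 2" | "r > 2" using r by linarith
  then show False
  proof cases
    case 1
    obtain s where s: "0 < s" "s < 1" "s\<^sup>2 < (s / 2) powr r" using exists_sq_less_powr[OF r(1) 1] .
    define t where "t = \<beta> * s"
    have t: "0 < t" using s \<beta> by (simp add: t_def)
    obtain v where v: "v \<in> vcarrier X" "vnorm X (vminus X v b) \<le> 1 / 2"
      and le: "\<And>t. vnorm X (vadd X a (vscale X t v)) \<le> vnorm X (vadd X y (vscale X t b))"
      using dom(2) ab norm_b unfolding dominated_def by fastforce
    have *: "norm (1 + \<tau> * \<phi> v) powr r + (norm \<tau> / 2) powr r \<le> \<alpha> powr r + norm (of_real \<beta> + \<tau>) powr r" for \<tau>
    proof -
      have "norm (1 + \<tau> * \<phi> v) powr r + norm (\<tau> * \<psi> v) powr r \<le> vnorm X (vadd X a (vscale X \<tau> v)) powr r"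
        using \<phi>\<psi>[of "vadd X a (vscale X \<tau> v)"] ab v \<phi>[of a v \<tau>] \<psi>[of a v \<tau>] vals by simp
      also have "\<dots> \<le> vnorm X (vadd X y (vscale X \<tau> b)) powr r"
        using le ab v r by (intro powr_mono2) auto
      also have "\<dots> = \<alpha> powr r + norm (of_real \<beta> + \<tau>) powr r"
        using \<alpha> by (simp add: ya norm_L)
      finally have "norm (1 + \<tau> * \<phi> v) powr r + norm (\<tau> * \<psi> v) powr r \<le> \<alpha> powr r + norm (of_real \<beta> + \<tau>) powr r" .
      moreover have "(norm \<tau> / 2) powr r \<le> norm (\<tau> * \<psi> v) powr r"
        using r \<psi>v[OF v] mult_left_mono[OF \<psi>v[OF v], of "norm \<tau>"]
        by (intro powr_mono2) (auto simp: norm_mult)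
      ultimately show ?thesis by simp
    qed
    \<comment> \<open>\<open>*\<close> is added for \<tau> = t and \<tau> = -t. At a the first
      coordinates contribute at least 2 and the second ones a term of order t powr r, whereas at y
      the parallelogram bound allows growth of second order only.\<close>
    have "2 + 2 * (t / 2) powr r \<le> norm (1 + of_real t * \<phi> v) powr r + norm (1 - of_real t * \<phi> v) powr r + 2 * (t / 2) powr r"
      using norm_add_powr_ge[OF r(1), of 1 "of_real t * \<phi> v"] by simp
    also have "\<dots> \<le> 2 * \<alpha> powr r + (norm (of_real \<beta> + of_real t :: 'k) powr r + norm (of_real \<beta> - of_real t :: 'k) powr r)"
      using *[of "of_real t"] *[of "- of_real t"] t by simp
    also have "\<dots> \<le> 2 * \<alpha> powr r + 2 * (\<beta>\<^sup>2 + t\<^sup>2) powr (r / 2)"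
      using parallelogram_powr_le[of r "of_real \<beta> :: 'k" "of_real t"] r 1 by simp
    also have "\<beta>\<^sup>2 + t\<^sup>2 = \<beta>\<^sup>2 * (1 + s\<^sup>2)" by (simp add: t_def power_mult_distrib algebra_simps)
    also have "(\<beta>\<^sup>2 * (1 + s\<^sup>2)) powr (r / 2) = \<beta> powr r * (1 + s\<^sup>2) powr (r / 2)"
      using \<beta> by (simp add: powr_mult sq_powr_half)
    \<comment> \<open>Here, and in the other case, the exponent r / 2 is replaced by 1, in the
      direction permitted by the sign of r - 2. What remains is a comparison of s^2 with a power s
      powr r.\<close>
    also have "2 * \<alpha> powr r + 2 * (\<beta> powr r * (1 + s\<^sup>2) powr (r / 2)) \<le> 2 * \<alpha> powr r + 2 * (\<beta> powr r * (1 + s\<^sup>2) powr 1)"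
      using 1 by (intro add_left_mono mult_left_mono powr_mono) auto
    also have "(t / 2) powr r = \<beta> powr r * (s / 2) powr r"
      using \<beta> s by (simp add: t_def flip: powr_mult)
    finally have "\<beta> powr r * (s / 2) powr r \<le> \<beta> powr r * s\<^sup>2"
      using \<alpha>r by (simp add: algebra_simps)
    then show False using s \<beta> by simp
  next
    case 2
    obtain s where s: "0 < s" "s < 1" "s powr r < s\<^sup>2 / 4" using exists_powr_less_sq[OF 2] .
    define t where "t = \<beta> * s"
    have t: "0 < t" using s \<beta> by (simp add: t_def)
    obtain v where v: "v \<in> vcarrier X" "vnorm X (vminus X v b) \<le> 1 / 2"
      and le: "\<And>t. vnorm X (vadd X y (vscale X t v)) \<le> vnorm X (vadd X a (vscale X t b))"
      using dom(1) ab norm_b unfolding dominated_def by fastforce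
    have *: "norm (of_real \<alpha> + \<tau> * \<phi> v) powr r + norm (of_real \<beta> + \<tau> * \<psi> v) powr r \<le> 1 + norm \<tau> powr r" for \<tau>
    proof -
      have "norm (of_real \<alpha> + \<tau> * \<phi> v) powr r + norm (of_real \<beta> + \<tau> * \<psi> v) powr r \<le> vnorm X (vadd X y (vscale X \<tau> v)) powr r"
        using \<phi>\<psi>[of "vadd X y (vscale X \<tau> v)"] y v \<phi>[of y v \<tau>] \<psi>[of y v \<tau>] \<psi>y by simp
      also have "\<dots> \<le> vnorm X (vadd X a (vscale X \<tau> b)) powr r"
        using le y v r by (intro powr_mono2) auto
      finally show ?thesis by (simp add: aa norm_L)
    qed
    \<comment> \<open>For r > 2 the roles change: y is the more curved point, so the lower bound is
      taken along the image direction at y and the exact value 1 + t powr r at a.\<close>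
    have "2 * \<alpha> powr r + 2 * (\<beta>\<^sup>2 * (1 + s\<^sup>2 / 4)) powr (r / 2)
        \<le> 2 * norm (of_real \<alpha> :: 'k) powr r + 2 * ((norm (of_real \<beta> :: 'k))\<^sup>2 + (norm (of_real t * \<psi> v))\<^sup>2) powr (r / 2)"
    proof -
      have "(t / 2)\<^sup>2 \<le> (norm (of_real t * \<psi> v))\<^sup>2"
        using t mult_left_mono[OF \<psi>v[OF v], of t] by (intro power_mono) (auto simp: norm_mult)
      then have "\<beta>\<^sup>2 * (1 + s\<^sup>2 / 4) \<le> (norm (of_real \<beta> :: 'k))\<^sup>2 + (norm (of_real t * \<psi> v))\<^sup>2"
        by (simp add: t_def power_mult_distrib power_divide algebra_simps)
      then show ?thesis using 2 \<alpha> by (simp add: powr_mono2)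
    qed
    also have "\<dots> \<le> (norm (of_real \<alpha> + of_real t * \<phi> v) powr r + norm (of_real \<alpha> - of_real t * \<phi> v) powr r)
        + (norm (of_real \<beta> + of_real t * \<psi> v) powr r + norm (of_real \<beta> - of_real t * \<psi> v) powr r)"
      using r 2 by (intro add_mono norm_add_powr_ge parallelogram_powr_ge) auto
    also have "\<dots> \<le> 2 + 2 * t powr r"
      using *[of "of_real t"] *[of "- of_real t"] t by simp
    also have "t powr r = \<beta> powr r * s powr r" using \<beta> s by (simp add: t_def powr_mult)
    also have "(\<beta>\<^sup>2 * (1 + s\<^sup>2 / 4)) powr (r / 2) = \<beta> powr r * (1 + s\<^sup>2 / 4) powr (r / 2)"
      using \<beta> by (simp add: powr_mult sq_powr_half)
    finally have "\<beta> powr r * ((1 + s\<^sup>2 / 4) powr (r / 2) - 1) \<le> \<beta> powr r * s powr r"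
      using \<alpha>r by (simp add: algebra_simps)
    then have "(1 + s\<^sup>2 / 4) powr (r / 2) - 1 \<le> s powr r" using \<beta> by simp
    moreover have "(1 + s\<^sup>2 / 4) powr 1 \<le> (1 + s\<^sup>2 / 4) powr (r / 2)"
      using 2 by (intro powr_mono) auto
    ultimately show False using s by simp
  qed
qed

section \<open>The Lebesgue spaces\<close>

lemma Lp_functions_measurable: "f \<in> Lp_functions p M \<Longrightarrow> f \<in> borel_measurable M"
  by (simp add: Lp_functions_def)

lemma Lp_functions_finite_iff:
  "p \<noteq> \<infinity> \<Longrightarrow> f \<in> Lp_functions p M \<longleftrightarrow>
     f \<in> borel_measurable M \<and> integrable M (\<lambda>x. norm (f x) powr enn2real p)"
  by (simp add: Lp_functions_def)

lemma ennreal_le_imp_le_enn2real: "\<lbrakk>ennreal x \<le> a; a < \<infinity>; 0 \<le> x\<rbrakk> \<Longrightarrow> x \<le> enn2real a"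
  using enn2real_mono[of "ennreal x" a] by simp

lemma powr_le_cancel:
  fixes a b r :: real
  assumes "a powr r \<le> b powr r" "0 \<le> b" "1 \<le> r"
  shows "a \<le> b"
proof (rule ccontr)
  assume "\<not> a \<le> b"
  then have "b powr r < a powr r" using assms by (intro powr_less_mono2) auto
  then show False using assms by simp
qed

lemma Lp_functions_infinity_iff:
  "f \<in> Lp_functions top M \<longleftrightarrow> f \<in> borel_measurable M \<and> (\<exists>C. AE x in M. norm (f x) \<le> C)"
proof -
  have "esssup M (\<lambda>x. ennreal (norm (f x))) < \<infinity> \<longleftrightarrow> (\<exists>C. AE x in M. norm (f x) \<le> C)"
    if "f \<in> borel_measurable M"
  proof
    assume fin: "esssup M (\<lambda>x. ennreal (norm (f x))) < \<infinity>"
    have "AE x in M. ennreal (norm (f x)) \<le> esssup M (\<lambda>x. ennreal (norm (f x)))"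
      by (rule esssup_AE)
    then have "AE x in M. norm (f x) \<le> enn2real (esssup M (\<lambda>x. ennreal (norm (f x))))"
      by eventually_elim (rule ennreal_le_imp_le_enn2real[OF _ fin norm_ge_zero])
    then show "\<exists>C. AE x in M. norm (f x) \<le> C" ..
  next
    assume "\<exists>C. AE x in M. norm (f x) \<le> C"
    then obtain C where "AE x in M. norm (f x) \<le> C" ..
    then have "AE x in M. ennreal (norm (f x)) \<le> ennreal C" by eventually_elim (rule ennreal_leI)
    then have "esssup M (\<lambda>x. ennreal (norm (f x))) \<le> ennreal C"
      using that by (intro esssup_I) auto
    then show "esssup M (\<lambda>x. ennreal (norm (f x))) < \<infinity>" by (simp add: le_less_trans)
  qed
  then show ?thesis by (auto simp: Lp_functions_def)
qed

lemma Lp_seminorm_nonneg [simp]: "0 \<le> Lp_seminorm p M f"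
  by (simp add: Lp_seminorm_def)

lemma AE_norm_le_Lp_seminorm_infinity:
  assumes "f \<in> Lp_functions \<infinity> M"
  shows "AE x in M. norm (f x) \<le> Lp_seminorm \<infinity> M f"
proof -
  have fin: "esssup M (\<lambda>x. ennreal (norm (f x))) < \<infinity>" using assms by (simp add: Lp_functions_def)
  have "AE x in M. ennreal (norm (f x)) \<le> esssup M (\<lambda>x. ennreal (norm (f x)))"
    by (rule esssup_AE)
  then have "AE x in M. norm (f x) \<le> enn2real (esssup M (\<lambda>x. ennreal (norm (f x))))"
    by eventually_elim (rule ennreal_le_imp_le_enn2real[OF _ fin norm_ge_zero])
  then show ?thesis by (simp add: Lp_seminorm_def)
qed

lemma Lp_seminorm_infinity_le:
  assumes "f \<in> borel_measurable M" "AE x in M. norm (f x) \<le> C" "0 \<le> C"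
  shows "Lp_seminorm \<infinity> M f \<le> C"
proof -
  have "AE x in M. ennreal (norm (f x)) \<le> ennreal C"
    using assms(2) by eventually_elim (rule ennreal_leI)
  then have "esssup M (\<lambda>x. ennreal (norm (f x))) \<le> ennreal C"
    using assms(1) by (intro esssup_I) auto
  then show ?thesis using assms(3) by (simp add: Lp_seminorm_def enn2real_leI)
qed

lemma enn2real_ge_1: "\<lbrakk>1 \<le> p; p \<noteq> \<infinity>\<rbrakk> \<Longrightarrow> 1 \<le> enn2real p"
  using enn2real_mono[of 1 p] by (simp add: less_top)

lemma Lp_seminorm_powr:
  assumes "1 \<le> p" "p \<noteq> \<infinity>"
  shows "Lp_seminorm p M f powr enn2real p = (\<integral>x. norm (f x) powr enn2real p \<partial>M)"
  using enn2real_ge_1[OF assms] assms(2)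
  by (simp add: Lp_seminorm_def powr_powr)

lemma Lp_seminorm_cong_AE:
  assumes "AE x in M. f x = g x" "f \<in> borel_measurable M" "g \<in> borel_measurable M"
  shows "Lp_seminorm p M f = Lp_seminorm p M (g :: 'a \<Rightarrow> 'k::real_normed_field)"
proof -
  have "esssup M (\<lambda>x. ennreal (norm (f x))) = esssup M (\<lambda>x. ennreal (norm (g x)))"
    using assms by (intro esssup_AE_cong) auto
  moreover have "(\<integral>x. norm (f x) powr enn2real p \<partial>M) = (\<integral>x. norm (g x) powr enn2real p \<partial>M)"
    using assms by (intro integral_cong_AE) auto
  ultimately show ?thesis by (simp add: Lp_seminorm_def)
qed

lemma Lp_seminorm_eq_0_iff:
  assumes p: "1 \<le> p" and f: "f \<in> Lp_functions p M"
  shows "Lp_seminorm p M f = 0 \<longleftrightarrow> (AE x in M. f x = 0)"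
proof (cases "p = \<infinity>")
  case True
  show ?thesis
  proof
    assume "Lp_seminorm p M f = 0"
    then show "AE x in M. f x = 0"
      using AE_norm_le_Lp_seminorm_infinity[of f M] f True by simp
  next
    assume "AE x in M. f x = 0"
    then have "Lp_seminorm \<infinity> M f \<le> 0"
      using f by (intro Lp_seminorm_infinity_le) (auto simp: Lp_functions_measurable)
    then show "Lp_seminorm p M f = 0" using True by (simp add: antisym)
  qed
next
  case False
  have "Lp_seminorm p M f = 0 \<longleftrightarrow> (\<integral>x. norm (f x) powr enn2real p \<partial>M) = 0"
    using Lp_seminorm_powr[OF p False, of M f] by (metis Lp_seminorm_nonneg powr_eq_0_iff)
  also have "\<dots> \<longleftrightarrow> (AE x in M. norm (f x) powr enn2real p = 0)"
    using f False by (intro integral_nonneg_eq_0_iff_AE) (auto simp: Lp_functions_finite_iff)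
  finally show ?thesis by simp
qed

lemma Lp_functions_zero [simp]: "(\<lambda>x. 0) \<in> Lp_functions p M"
  by (cases "p = \<infinity>") (auto simp: Lp_functions_infinity_iff Lp_functions_finite_iff)

lemma Lp_functions_scale:
  assumes "f \<in> Lp_functions p M"
  shows "(\<lambda>x. c * f x) \<in> Lp_functions p (M :: 'a measure)"
    and "1 \<le> p \<Longrightarrow> Lp_seminorm p M (\<lambda>x. c * f x) = norm c * Lp_seminorm p M (f :: 'a \<Rightarrow> 'k::{real_normed_field,euclidean_space})"
proof -
  note [measurable] = Lp_functions_measurable[OF assms]
  show scale: "(\<lambda>x. c * f x) \<in> Lp_functions p M" for c
  proof (cases "p = \<infinity>")
    case True
    obtain C where "AE x in M. norm (f x) \<le> C"
      using assms by (auto simp: True Lp_functions_infinity_iff)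
    then have "AE x in M. norm (c * f x) \<le> norm c * C"
      by eventually_elim (simp add: norm_mult mult_left_mono)
    then show ?thesis by (auto simp: True Lp_functions_infinity_iff)
  next
    case False
    then show ?thesis using assms by (auto simp: Lp_functions_finite_iff norm_mult powr_mult)
  qed
  assume p: "1 \<le> p"
  show "Lp_seminorm p M (\<lambda>x. c * f x) = norm c * Lp_seminorm p M f"
  proof (cases "p = \<infinity>")
    case True
    have le: "Lp_seminorm p M (\<lambda>x. c * g x) \<le> norm c * Lp_seminorm p M g"
      if "g \<in> Lp_functions p M" for c and g :: "'a \<Rightarrow> 'k"
    proof -
      have [measurable]: "g \<in> borel_measurable M" using that by (rule Lp_functions_measurable)
      have "AE x in M. norm (g x) \<le> Lp_seminorm p M g"
        using AE_norm_le_Lp_seminorm_infinity that unfolding True by blast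
      then have "AE x in M. norm (c * g x) \<le> norm c * Lp_seminorm p M g"
        by eventually_elim (simp add: norm_mult mult_left_mono)
      then show ?thesis unfolding True by (intro Lp_seminorm_infinity_le) auto
    qed
    show ?thesis
    proof (cases "c = 0")
      case True
      then show ?thesis using Lp_seminorm_eq_0_iff[OF p, of "\<lambda>x. 0" M] by simp
    next
      case False
      \<comment> \<open>The reverse inequality is \<open>le\<close> for the scalar inverse
        c.\<close>
      have "Lp_seminorm p M (\<lambda>x. inverse c * (c * f x)) \<le> norm (inverse c) * Lp_seminorm p M (\<lambda>x. c * f x)"
        by (rule le[OF scale])
      then have "Lp_seminorm p M f \<le> norm (inverse c) * Lp_seminorm p M (\<lambda>x. c * f x)"
        using False by (simp flip: mult.assoc)
      then have "norm c * Lp_seminorm p M f \<le> Lp_seminorm p M (\<lambda>x. c * f x)"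
        using False by (simp add: norm_inverse norm_divide field_simps)
      then show ?thesis using le[OF assms] by (simp add: antisym)
    qed
  next
    case False
    have "Lp_seminorm p M (\<lambda>x. c * f x) powr enn2real p = (norm c * Lp_seminorm p M f) powr enn2real p"
      by (simp add: Lp_seminorm_powr[OF p False] powr_mult norm_mult)
    note eq = this
    show ?thesis
      by (rule antisym; rule powr_le_cancel[of _ "enn2real p"])
        (simp_all add: eq enn2real_ge_1[OF p False])
  qed
qed

text \<open>u + w is F + G times the convex combination of u / F and w / G with weights F / (F + G)
  and G / (F + G). If F and G are the seminorms, the right side integrates to (F + G) powr r, which
  is Minkowski's inequality; F = G = 1 gives closure under addition.\<close>

lemma norm_add_powr_le:
  fixes u w :: "'k::real_normed_vector"
  assumes "1 \<le> r" "0 < F" "0 < G"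
  shows "norm (u + w) powr r \<le>
    (F + G) powr r * (F / (F + G) * (norm u powr r / F powr r) + G / (F + G) * (norm w powr r / G powr r))"
proof -
  have FG: "F + G > 0" "F / (F + G) + G / (F + G) = 1"
    using assms by (simp_all flip: add_divide_distrib)
  have "norm (u + w) powr r \<le> (norm u + norm w) powr r"
    using assms by (intro powr_mono2 norm_triangle_ineq) auto
  also have "norm u + norm w = (F + G) * (F / (F + G) * (norm u / F) + G / (F + G) * (norm w / G))"
    using assms FG(1) by (simp add: distrib_left)
  also have "\<dots> powr r = (F + G) powr r * (F / (F + G) * (norm u / F) + G / (F + G) * (norm w / G)) powr r"
    by (rule powr_mult)
  also have "\<dots> \<le> (F + G) powr r * (F / (F + G) * (norm u / F) powr r + G / (F + G) * (norm w / G) powr r)"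
    using assms FG by (intro mult_left_mono powr_convex_combination) auto
  finally show ?thesis using assms by (simp add: powr_divide)
qed

lemma Lp_functions_add:
  fixes f g :: "'a \<Rightarrow> 'k::{real_normed_field,euclidean_space}"
  assumes p: "1 \<le> p" and f: "f \<in> Lp_functions p M" and g: "g \<in> Lp_functions p M"
  shows "(\<lambda>x. f x + g x) \<in> Lp_functions p M"
proof (cases "p = \<infinity>")
  case True
  obtain C D where "AE x in M. norm (f x) \<le> C" "AE x in M. norm (g x) \<le> D"
    using f g by (auto simp: True Lp_functions_infinity_iff)
  then have "AE x in M. norm (f x + g x) \<le> C + D"
    by eventually_elim (use norm_triangle_mono in blast)
  then show ?thesis using f g by (auto simp: True Lp_functions_infinity_iff)
next
  case False
  note [measurable] = Lp_functions_measurable[OF f] Lp_functions_measurable[OF g]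
  define r where "r = enn2real p"
  have r: "1 \<le> r" using enn2real_ge_1[OF p False] by (simp add: r_def)
  have "integrable M (\<lambda>x. norm (f x + g x) powr r)"
  proof (rule Bochner_Integration.integrable_bound)
    show "integrable M (\<lambda>x. 2 powr r * (1 / 2 * norm (f x) powr r + 1 / 2 * norm (g x) powr r))"
      using f g False by (simp add: Lp_functions_finite_iff r_def)
    show "AE x in M. norm (norm (f x + g x) powr r)
        \<le> norm (2 powr r * (1 / 2 * norm (f x) powr r + 1 / 2 * norm (g x) powr r))"
    proof (rule AE_I2)
      fix x show "norm (norm (f x + g x) powr r)
          \<le> norm (2 powr r * (1 / 2 * norm (f x) powr r + 1 / 2 * norm (g x) powr r))"
        using norm_add_powr_le[OF r, of 1 1 "f x" "g x"] by simp
    qed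
  qed measurable
  then show ?thesis using False by (simp add: Lp_functions_finite_iff r_def)
qed

theorem Minkowski_inequality:
  fixes f g :: "'a \<Rightarrow> 'k::{real_normed_field,euclidean_space}"
  assumes p: "1 \<le> p" and f: "f \<in> Lp_functions p M" and g: "g \<in> Lp_functions p M"
  shows "Lp_seminorm p M (\<lambda>x. f x + g x) \<le> Lp_seminorm p M f + Lp_seminorm p M g"
proof -
  note [measurable] = Lp_functions_measurable[OF f] Lp_functions_measurable[OF g]
  define F G where "F = Lp_seminorm p M f" and "G = Lp_seminorm p M g"
  have FG: "F \<ge> 0" "G \<ge> 0" by (simp_all add: F_def G_def)
  \<comment> \<open>The convexity argument divides by both seminorms; if one vanishes, its function
    is 0 almost everywhere.\<close>
  consider "p = \<infinity>" | "p \<noteq> \<infinity>" "F = 0" | "p \<noteq> \<infinity>" "G = 0" | "p \<noteq> \<infinity>" "F > 0" "G > 0"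
    using FG by fastforce
  then show ?thesis
  proof cases
    case 1
    have "AE x in M. norm (f x) \<le> F" "AE x in M. norm (g x) \<le> G"
      using AE_norm_le_Lp_seminorm_infinity f g unfolding F_def G_def 1 by blast+
    then have "AE x in M. norm (f x + g x) \<le> F + G"
      by eventually_elim (use norm_triangle_mono in blast)
    then show ?thesis using FG unfolding 1 F_def G_def by (intro Lp_seminorm_infinity_le) auto
  next
    case 2
    then have "AE x in M. f x = 0" using Lp_seminorm_eq_0_iff[OF p f] by (simp add: F_def)
    then have "AE x in M. f x + g x = g x" by eventually_elim simp
    then have "Lp_seminorm p M (\<lambda>x. f x + g x) = G" unfolding G_def by (rule Lp_seminorm_cong_AE) auto
    then show ?thesis using FG by (simp add: F_def G_def)
  next
    case 3
    then have "AE x in M. g x = 0" using Lp_seminorm_eq_0_iff[OF p g] by (simp add: G_def)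
    then have "AE x in M. f x + g x = f x" by eventually_elim simp
    then have "Lp_seminorm p M (\<lambda>x. f x + g x) = F" unfolding F_def by (rule Lp_seminorm_cong_AE) auto
    then show ?thesis using FG by (simp add: F_def G_def)
  next
    case 4
    define r where "r = enn2real p"
    have r: "1 \<le> r" using enn2real_ge_1[OF p 4(1)] by (simp add: r_def)
    have int: "integrable M (\<lambda>x. norm (f x) powr r)" "integrable M (\<lambda>x. norm (g x) powr r)"
      using f g 4 by (simp_all add: Lp_functions_finite_iff r_def)
    have FG_int: "(\<integral>x. norm (f x) powr r \<partial>M) = F powr r" "(\<integral>x. norm (g x) powr r \<partial>M) = G powr r"
      by (simp_all add: r_def F_def G_def Lp_seminorm_powr[OF p 4(1)])
    have "Lp_seminorm p M (\<lambda>x. f x + g x) powr r = (\<integral>x. norm (f x + g x) powr r \<partial>M)"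
      using Lp_seminorm_powr[OF p 4(1)] by (simp add: r_def)
    also have "\<dots> \<le> (\<integral>x. (F + G) powr r * (F / (F + G) * (norm (f x) powr r / F powr r)
        + G / (F + G) * (norm (g x) powr r / G powr r)) \<partial>M)"
      using int Lp_functions_add[OF p f g] 4 norm_add_powr_le[OF r 4(2,3)]
      by (intro integral_mono) (auto simp: Lp_functions_finite_iff r_def)
    also have "\<dots> = (F + G) powr r * (F / (F + G) + G / (F + G))"
      using int 4 by (simp add: FG_int)
    also have "\<dots> = (F + G) powr r" using 4 by (simp flip: add_divide_distrib)
    finally show ?thesis
      unfolding F_def[symmetric] G_def[symmetric] by (rule powr_le_cancel) (use r FG in simp_all)
  qed
qed

section \<open>Classes of almost everywhere equal functions\<close>

definition Lp_class :: "ennreal \<Rightarrow> 'a measure \<Rightarrow> ('a \<Rightarrow> 'k::real_normed_field) \<Rightarrow> ('a \<Rightarrow> 'k) set" where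
  "Lp_class p M f = Lp_rel p M `` {f}"

text \<open>Carries integral formulas from functions to classes; the choice alters the integrand on
  a null set only.\<close>

definition Lp_rep :: "('a \<Rightarrow> 'k::real_normed_field) set \<Rightarrow> 'a \<Rightarrow> 'k" where
  "Lp_rep A = (SOME f. f \<in> A)"

lemma mem_Lp_class_iff:
  "g \<in> Lp_class p M f \<longleftrightarrow> f \<in> Lp_functions p M \<and> g \<in> Lp_functions p M \<and> (AE x in M. f x = g x)"
  by (simp add: Lp_class_def Lp_rel_def)

lemma Lp_class_eq_iff:
  assumes "f \<in> Lp_functions p M" "g \<in> Lp_functions p M"
  shows "Lp_class p M f = Lp_class p M g \<longleftrightarrow> (AE x in M. f x = g x)"
proof
  assume "Lp_class p M f = Lp_class p M g"
  then have "g \<in> Lp_class p M f" using assms by (simp add: mem_Lp_class_iff)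
  then show "AE x in M. f x = g x" by (simp add: mem_Lp_class_iff)
next
  assume eq: "AE x in M. f x = g x"
  show "Lp_class p M f = Lp_class p M g"
  proof (intro set_eqI)
    fix h
    have "(AE x in M. f x = h x) \<longleftrightarrow> (AE x in M. g x = h x)"
      by (rule eventually_cong[OF eq]) simp
    then show "h \<in> Lp_class p M f \<longleftrightarrow> h \<in> Lp_class p M g"
      using assms by (simp add: mem_Lp_class_iff)
  qed
qed

lemma Lp_carrier: "vcarrier (Lp_space p M) = Lp_class p M ` Lp_functions p M"
  by (auto simp: Lp_space_def quotient_def Lp_class_def)

lemma Lp_class_carrier [simp]: "f \<in> Lp_functions p M \<Longrightarrow> Lp_class p M f \<in> vcarrier (Lp_space p M)"
  by (simp add: Lp_carrier)

lemma Lp_zero: "vzero (Lp_space p M) = Lp_class p M (\<lambda>x. 0)"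
  by (simp add: Lp_space_def Lp_class_def)

lemma Lp_norm:
  assumes "f \<in> Lp_functions p M"
  shows "vnorm (Lp_space p M) (Lp_class p M f) = Lp_seminorm p M f"
proof -
  have "Lp_seminorm p M ` Lp_class p M f = {Lp_seminorm p M f}"
  proof
    show "Lp_seminorm p M ` Lp_class p M f \<subseteq> {Lp_seminorm p M f}"
      by (auto simp: mem_Lp_class_iff intro!: Lp_seminorm_cong_AE[symmetric] dest: Lp_functions_measurable)
    show "{Lp_seminorm p M f} \<subseteq> Lp_seminorm p M ` Lp_class p M f"
      using assms by (auto simp: mem_Lp_class_iff)
  qed
  then show ?thesis by (simp add: Lp_space_def)
qed

lemma Lp_add:
  fixes f g :: "'a \<Rightarrow> 'k::{real_normed_field,euclidean_space}"
  assumes p: "1 \<le> p" and f: "f \<in> Lp_functions p M" and g: "g \<in> Lp_functions p M"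
  shows "vadd (Lp_space p M) (Lp_class p M f) (Lp_class p M g) = Lp_class p M (\<lambda>x. f x + g x)"
proof -
  have "Lp_class p M (\<lambda>x. f' x + g' x) = Lp_class p M (\<lambda>x. f x + g x)"
    if "f' \<in> Lp_class p M f" "g' \<in> Lp_class p M g" for f' g'
  proof -
    have *: "f' \<in> Lp_functions p M" "g' \<in> Lp_functions p M" "AE x in M. f x = f' x" "AE x in M. g x = g' x"
      using that by (simp_all add: mem_Lp_class_iff)
    have "AE x in M. f' x + g' x = f x + g x" using *(3,4) by eventually_elim simp
    then show ?thesis using Lp_functions_add[OF p] * f g by (subst Lp_class_eq_iff) auto
  qed
  moreover have "f \<in> Lp_class p M f" "g \<in> Lp_class p M g" using f g by (simp_all add: mem_Lp_class_iff)
  ultimately have "(\<Union>f'\<in>Lp_class p M f. \<Union>g'\<in>Lp_class p M g. Lp_class p M (\<lambda>x. f' x + g' x))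
      = Lp_class p M (\<lambda>x. f x + g x)"
    by blast
  then show ?thesis by (simp add: Lp_space_def Lp_class_def)
qed

lemma Lp_scale:
  fixes f :: "'a \<Rightarrow> 'k::{real_normed_field,euclidean_space}"
  assumes f: "f \<in> Lp_functions p M"
  shows "vscale (Lp_space p M) c (Lp_class p M f) = Lp_class p M (\<lambda>x. c * f x)"
proof -
  have "Lp_class p M (\<lambda>x. c * f' x) = Lp_class p M (\<lambda>x. c * f x)"
    if "f' \<in> Lp_class p M f" for f'
  proof -
    have *: "f' \<in> Lp_functions p M" "AE x in M. f x = f' x"
      using that by (simp_all add: mem_Lp_class_iff)
    have "AE x in M. c * f' x = c * f x" using *(2) by eventually_elim simp
    then show ?thesis using Lp_functions_scale(1) * f by (subst Lp_class_eq_iff) auto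
  qed
  moreover have "f \<in> Lp_class p M f" using f by (simp add: mem_Lp_class_iff)
  ultimately have "(\<Union>f'\<in>Lp_class p M f. Lp_class p M (\<lambda>x. c * f' x)) = Lp_class p M (\<lambda>x. c * f x)"
    by blast
  then show ?thesis by (simp add: Lp_space_def Lp_class_def)
qed

lemma Lp_rep:
  assumes "f \<in> Lp_functions p M"
  shows "Lp_rep (Lp_class p M f) \<in> Lp_functions p M" "AE x in M. Lp_rep (Lp_class p M f) x = f x"
proof -
  have "Lp_rep (Lp_class p M f) \<in> Lp_class p M f"
    unfolding Lp_rep_def by (rule someI[of _ f]) (simp add: mem_Lp_class_iff assms)
  then show "Lp_rep (Lp_class p M f) \<in> Lp_functions p M" "AE x in M. Lp_rep (Lp_class p M f) x = f x"
    by (auto simp: mem_Lp_class_iff eq_commute)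
qed

lemma normed_vector_space_Lp:
  assumes p: "1 \<le> p"
  shows "normed_vector_space (Lp_space p M :: ('k::{real_normed_field,euclidean_space}, ('a \<Rightarrow> 'k) set) normed_vs)"
proof -
  note add = Lp_functions_add[OF p] and scale = Lp_functions_scale(1)
  note simps = Lp_add[OF p] Lp_scale Lp_zero Lp_norm add scale Lp_functions_scale(2)[OF _ p]
  show ?thesis
    by (unfold_locales; unfold Lp_carrier; (elim imageE)?)
      (simp_all add: simps Minkowski_inequality[OF p] algebra_simps Lp_class_eq_iff Lp_seminorm_eq_0_iff[OF p])
qed

text \<open>Makes \<open>cj\<close> measurable and lets it pass through the integral.\<close>

lemma (in scalar_conjugation) cj_bounded_linear: "bounded_linear cj"
  by (rule bounded_linear_intro[of _ 1]) (simp_all add: scaleR_conv_of_real cj_add cj_mult)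

lemma L2_hilbertian:
  fixes cj :: "'k::{real_normed_field,euclidean_space} \<Rightarrow> 'k" and M :: "'a measure"
  assumes "scalar_conjugation cj"
  shows "hilbertian_norm cj (Lp_space 2 M :: ('k, ('a \<Rightarrow> 'k) set) normed_vs)"
proof -
  interpret scalar_conjugation cj by (rule assms)
  have bl: "bounded_linear cj" by (rule cj_bounded_linear)
  have [measurable]: "cj \<in> borel_measurable borel"
    by (intro borel_measurable_continuous_onI linear_continuous_on bl)
  let ?X = "Lp_space 2 M :: ('k, ('a \<Rightarrow> 'k) set) normed_vs"
  have sq: "integrable M (\<lambda>x. (norm (f x))\<^sup>2)" and meas: "f \<in> borel_measurable M"
    if "f \<in> Lp_functions 2 M" for f :: "'a \<Rightarrow> 'k"
    using that by (simp_all add: Lp_functions_finite_iff)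
  have int: "integrable M (\<lambda>x. f x * cj (g x))"
    if fg: "f \<in> Lp_functions 2 M" "g \<in> Lp_functions 2 M" for f g :: "'a \<Rightarrow> 'k"
  proof (rule Bochner_Integration.integrable_bound)
    show "integrable M (\<lambda>x. (norm (f x))\<^sup>2 + (norm (g x))\<^sup>2)" using sq fg by simp
    show "(\<lambda>x. f x * cj (g x)) \<in> borel_measurable M" using meas[OF fg(1)] meas[OF fg(2)] by measurable
    have "norm (f x * cj (g x)) \<le> (norm (f x))\<^sup>2 + (norm (g x))\<^sup>2" for x
    proof -
      have "2 * (norm (f x) * norm (g x)) \<le> (norm (f x))\<^sup>2 + (norm (g x))\<^sup>2"
        using sum_squares_bound[of "norm (f x)" "norm (g x)"] by simp
      moreover have "0 \<le> norm (f x) * norm (g x)" by simp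
      ultimately show ?thesis unfolding norm_mult norm_cj by linarith
    qed
    then show "AE x in M. norm (f x * cj (g x)) \<le> norm ((norm (f x))\<^sup>2 + (norm (g x))\<^sup>2)" by simp
  qed
  define ip where "ip A B = (\<integral>x. Lp_rep A x * cj (Lp_rep B x) \<partial>M)" for A B :: "('a \<Rightarrow> 'k) set"
  have ip: "ip (Lp_class 2 M f) (Lp_class 2 M g) = (\<integral>x. f x * cj (g x) \<partial>M)"
    if fg: "f \<in> Lp_functions 2 M" "g \<in> Lp_functions 2 M" for f g :: "'a \<Rightarrow> 'k"
  proof -
    note r = Lp_rep[OF fg(1)] Lp_rep[OF fg(2)]
    note [measurable] = meas[OF fg(1)] meas[OF fg(2)] meas[OF r(1)] meas[OF r(3)]
    have "AE x in M. Lp_rep (Lp_class 2 M f) x * cj (Lp_rep (Lp_class 2 M g) x) = f x * cj (g x)"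
      using r(2,4) by eventually_elim simp
    then show ?thesis unfolding ip_def by (intro integral_cong_AE) auto
  qed
  have self: "ip (Lp_class 2 M f) (Lp_class 2 M f) = of_real ((Lp_seminorm 2 M f)\<^sup>2)"
    if f: "f \<in> Lp_functions 2 M" for f
  proof -
    have "(Lp_seminorm 2 M f)\<^sup>2 = (\<integral>x. (norm (f x))\<^sup>2 \<partial>M)"
      using Lp_seminorm_powr[of 2 M f] by simp
    then show ?thesis using sq[OF f] by (simp add: ip[OF f f] mult_cj integral_of_real flip: of_real_power)
  qed
  have two: "(1::ennreal) \<le> 2" by simp
  note Lp = Lp_functions_add[OF two] Lp_functions_scale(1) Lp_add[OF two] Lp_scale
  have "inner_product_on cj ?X ip"
    unfolding inner_product_on_def Lp_carrier
  proof (intro conjI ballI allI impI; elim imageE; hypsubst)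
    fix f g h :: "'a \<Rightarrow> 'k"
    assume fgh: "f \<in> Lp_functions 2 M" "g \<in> Lp_functions 2 M" "h \<in> Lp_functions 2 M"
    show "ip (vadd ?X (Lp_class 2 M f) (Lp_class 2 M g)) (Lp_class 2 M h)
        = ip (Lp_class 2 M f) (Lp_class 2 M h) + ip (Lp_class 2 M g) (Lp_class 2 M h)"
      using fgh int by (simp add: Lp ip distrib_right)
  next
    fix c and f g :: "'a \<Rightarrow> 'k"
    assume fg: "f \<in> Lp_functions 2 M" "g \<in> Lp_functions 2 M"
    show "ip (vscale ?X c (Lp_class 2 M f)) (Lp_class 2 M g) = c * ip (Lp_class 2 M f) (Lp_class 2 M g)"
      using fg by (simp add: Lp ip mult.assoc)
  next
    fix f g :: "'a \<Rightarrow> 'k"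
    assume fg: "f \<in> Lp_functions 2 M" "g \<in> Lp_functions 2 M"
    have "cj (\<integral>x. f x * cj (g x) \<partial>M) = (\<integral>x. cj (f x * cj (g x)) \<partial>M)"
      by (rule integral_bounded_linear[OF bl int[OF fg], symmetric])
    then show "ip (Lp_class 2 M g) (Lp_class 2 M f) = cj (ip (Lp_class 2 M f) (Lp_class 2 M g))"
      using fg by (simp add: ip cj_mult mult.commute)
  next
    fix f :: "'a \<Rightarrow> 'k"
    assume f: "f \<in> Lp_functions 2 M" "Lp_class 2 M f \<noteq> vzero ?X"
    then have "Lp_seminorm 2 M f \<noteq> 0"
      by (simp add: Lp_seminorm_eq_0_iff Lp_zero Lp_class_eq_iff)
    then show "\<exists>r>0. ip (Lp_class 2 M f) (Lp_class 2 M f) = of_real r"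
      using f by (intro exI[of _ "(Lp_seminorm 2 M f)\<^sup>2"]) (simp only: self, simp)
  qed
  moreover have "\<forall>A\<in>vcarrier ?X. ip A A = of_real ((vnorm ?X A)\<^sup>2)"
    unfolding Lp_carrier by (auto simp only: self Lp_norm)
  ultimately show ?thesis unfolding hilbertian_norm_def by blast
qed

section \<open>Atoms and dimension\<close>

text \<open>A cannot be split, so for each member U of a countable base, h lies in U almost
  everywhere on A or almost nowhere. Off one null set all points of A give the same answers, and a
  base separates points.\<close>

lemma AE_constant_on_atom:
  fixes h :: "'a \<Rightarrow> 'b::{second_countable_topology,t2_space}"
  assumes A: "A \<in> sets M" and h [measurable]: "h \<in> borel_measurable M"
    and atom: "\<And>E. \<lbrakk>E \<in> sets M; E \<subseteq> A\<rbrakk> \<Longrightarrow> emeasure M E = 0 \<or> emeasure M (A - E) = 0"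
  shows "\<exists>c. AE x in M. x \<in> A \<longrightarrow> h x = c"
proof (cases "AE x in M. x \<notin> A")
  case False
  obtain B :: "'b set set" where B: "countable B" "topological_basis B"
    using ex_countable_basis by blast
  have "\<exists>P. AE x in M. x \<in> A \<longrightarrow> (h x \<in> U \<longleftrightarrow> P)" if "U \<in> B" for U
  proof -
    have "open U" using B that topological_basis_open by blast
    then have U [measurable]: "U \<in> sets borel" by simp
    define E where "E = {x \<in> space M. h x \<in> U} \<inter> A"
    have E: "E \<in> sets M" "E \<subseteq> A" using A by (auto simp: E_def)
    have sp: "A \<subseteq> space M" using A by (rule sets.sets_into_space)
    from atom[OF E] show ?thesis
    proof
      assume "emeasure M E = 0"
      then have "AE x in M. x \<notin> E" using E by (intro AE_not_in) (auto simp: null_sets_def)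
      then have "AE x in M. x \<in> A \<longrightarrow> (h x \<in> U \<longleftrightarrow> False)"
        by eventually_elim (use sp in \<open>auto simp: E_def\<close>)
      then show ?thesis ..
    next
      assume "emeasure M (A - E) = 0"
      then have "AE x in M. x \<notin> A - E" using E A by (intro AE_not_in) (auto simp: null_sets_def)
      then have "AE x in M. x \<in> A \<longrightarrow> (h x \<in> U \<longleftrightarrow> True)"
        by eventually_elim (auto simp: E_def)
      then show ?thesis ..
    qed
  qed
  then obtain P where "AE x in M. x \<in> A \<longrightarrow> (h x \<in> U \<longleftrightarrow> P U)" if "U \<in> B" for U
    by metis
  then have P: "AE x in M. \<forall>U\<in>B. x \<in> A \<longrightarrow> (h x \<in> U \<longleftrightarrow> P U)"
    by (intro AE_ball_countable'[OF _ B(1)]) auto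
  \<comment> \<open>A is not null, so it has a point outside the exceptional set; the value there is
    the constant.\<close>
  obtain x0 where x0: "x0 \<in> A" "\<And>U. U \<in> B \<Longrightarrow> h x0 \<in> U \<longleftrightarrow> P U"
  proof (rule ccontr)
    assume *: "\<not> thesis"
    have "AE x in M. x \<notin> A"
      using P by eventually_elim (use * that in blast)
    then show False using False by contradiction
  qed
  have "AE x in M. x \<in> A \<longrightarrow> h x = h x0"
    using P
  proof eventually_elim
    case (elim x)
    show ?case
    proof (intro impI, rule ccontr)
      assume "x \<in> A" "h x \<noteq> h x0"
      then obtain V where V: "open V" "h x \<in> V" "h x0 \<notin> V" using t1_space by blast
      then obtain U where "U \<in> B" "h x \<in> U" "U \<subseteq> V" using topological_basisE[OF B(2)] by metis
      then show False using elim x0 V \<open>x \<in> A\<close> by blast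
    qed
  qed
  then show ?thesis ..
qed auto

text \<open>The generator is a nonzero class and not the indicator of A, so membership of the
  indicator in the space never has to be shown.\<close>

lemma Lp_one_dimensionalI:
  fixes M :: "'a measure" and p :: ennreal
  defines "X \<equiv> (Lp_space p M :: ('k::{real_normed_field,euclidean_space}, ('a \<Rightarrow> 'k) set) normed_vs)"
  assumes ind: "\<And>f :: 'a \<Rightarrow> 'k. f \<in> Lp_functions p M \<Longrightarrow> \<exists>c. AE x in M. f x = c * indicator A x"
    and nz: "vcarrier X \<noteq> {vzero X}"
  shows "one_dimensional X"
proof -
  obtain f where f: "f \<in> Lp_functions p M" "Lp_class p M f \<noteq> vzero X"
    using nz Lp_functions_zero[of p M] unfolding X_def Lp_carrier Lp_zero by blast
  then have f0: "\<not> (AE x in M. f x = 0)" by (simp add: X_def Lp_zero Lp_class_eq_iff)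
  obtain c where c: "AE x in M. f x = c * indicator A x" using ind[OF f(1)] ..
  have c0: "c \<noteq> 0" using f0 c by auto
  have "vcarrier X \<subseteq> range (\<lambda>d. vscale X d (Lp_class p M f))"
  proof
    fix G assume "G \<in> vcarrier X"
    then obtain g where g: "g \<in> Lp_functions p M" "G = Lp_class p M g"
      by (auto simp: X_def Lp_carrier)
    obtain d where d: "AE x in M. g x = d * indicator A x" using ind[OF g(1)] ..
    have "AE x in M. g x = d / c * f x" using c d by eventually_elim (use c0 in simp)
    then have "G = vscale X (d / c) (Lp_class p M f)"
      unfolding X_def Lp_scale[OF f(1)] g(2)
      by (subst Lp_class_eq_iff[OF g(1) Lp_functions_scale(1)[OF f(1)]])
    then show "G \<in> range (\<lambda>d. vscale X d (Lp_class p M f))" by blast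
  qed
  moreover have "range (\<lambda>d. vscale X d (Lp_class p M f)) \<subseteq> vcarrier X"
    using f by (auto simp: X_def Lp_scale Lp_functions_scale)
  ultimately show ?thesis
    unfolding one_dimensional_def using f by (intro bexI[of _ "Lp_class p M f"]) (auto simp: X_def)
qed

text \<open>Otherwise the whole space cannot be split, and by \<open>AE_constant_on_atom\<close>
  every function is constant almost everywhere.\<close>

lemma Lp_infinity_disjoint_sets:
  fixes M :: "'a measure"
  defines "X \<equiv> (Lp_space \<infinity> M :: ('k::{real_normed_field,euclidean_space}, ('a \<Rightarrow> 'k) set) normed_vs)"
  assumes nz: "vcarrier X \<noteq> {vzero X}" and dim: "\<not> one_dimensional X"
  obtains E where "E \<in> sets M" "emeasure M E \<noteq> 0" "emeasure M (space M - E) \<noteq> 0"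
proof (rule ccontr)
  assume "\<not> thesis"
  then have atom: "\<And>E. \<lbrakk>E \<in> sets M; E \<subseteq> space M\<rbrakk> \<Longrightarrow> emeasure M E = 0 \<or> emeasure M (space M - E) = 0"
    using that by blast
  have "\<exists>c. AE x in M. f x = c * indicator (space M) x" if f: "f \<in> Lp_functions \<infinity> M" for f :: "'a \<Rightarrow> 'k"
  proof -
    obtain c where "AE x in M. x \<in> space M \<longrightarrow> f x = c"
      using AE_constant_on_atom[OF sets.top Lp_functions_measurable[OF f] atom] by blast
    then have "AE x in M. f x = c * indicator (space M) x"
      using AE_space by eventually_elim simp
    then show ?thesis ..
  qed
  then show False using Lp_one_dimensionalI[of \<infinity> M "space M"] nz dim unfolding X_def by blast
qed

lemma Lp_level_set_finite:
  assumes p: "1 \<le> p" "p \<noteq> \<infinity>" and f: "f \<in> Lp_functions p M" and c: "0 < c"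
  shows "emeasure M {x \<in> space M. c \<le> norm (f x)} < \<infinity>"
proof -
  have [measurable]: "f \<in> borel_measurable M" by (rule Lp_functions_measurable[OF f])
  define r where "r = enn2real p"
  have r: "1 \<le> r" using enn2real_ge_1[OF p] by (simp add: r_def)
  have int: "integrable M (\<lambda>x. norm (f x) powr r)" using f p by (simp add: Lp_functions_finite_iff r_def)
  have "emeasure M {x \<in> space M. c \<le> norm (f x)} \<le> emeasure M {x \<in> space M. c powr r \<le> norm (f x) powr r}"
    using r c by (intro emeasure_mono) (auto intro: powr_mono2)
  also have "\<dots> \<le> (1 / (c powr r)) * (\<integral>x. norm (f x) powr r \<partial>M)"
    using c by (intro integral_Markov_inequality[OF int]) auto
  also have "\<dots> < \<infinity>" by simp
  finally show ?thesis .
qed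

text \<open>The candidates are level sets, which exhaust the set where a function is nonzero. If the
  claim fails, a level set A of positive measure cannot be split and every level set is null outside
  A, so each function is almost everywhere a multiple of the indicator of A.\<close>

lemma Lp_disjoint_sets:
  fixes M :: "'a measure" and p :: ennreal
  defines "X \<equiv> (Lp_space p M :: ('k::{real_normed_field,euclidean_space}, ('a \<Rightarrow> 'k) set) normed_vs)"
  assumes p: "1 \<le> p" "p \<noteq> \<infinity>" and nz: "vcarrier X \<noteq> {vzero X}" and dim: "\<not> one_dimensional X"
  obtains A B where "A \<in> sets M" "B \<in> sets M" "A \<inter> B = {}" "emeasure M A \<noteq> 0" "emeasure M B \<noteq> 0"
    "emeasure M A < \<infinity>" "emeasure M B < \<infinity>"
proof (rule ccontr)
  assume neg: "\<not> thesis"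
  note thesisI = that
  have disj: "emeasure M A = 0 \<or> emeasure M B = 0"
    if "A \<in> sets M" "B \<in> sets M" "A \<inter> B = {}" "emeasure M A < \<infinity>" "emeasure M B < \<infinity>" for A B
    using thesisI[OF that(1-3) _ _ that(4,5)] neg by blast
  define L where "L f n = {x \<in> space M. inverse (real (Suc n)) \<le> norm (f x)}" for f :: "'a \<Rightarrow> 'k" and n
  have L: "L f n \<in> sets M" "emeasure M (L f n) < \<infinity>" if "f \<in> Lp_functions p M" for f n
    using that Lp_level_set_finite[OF p that, of "inverse (real (Suc n))"] Lp_functions_measurable[OF that]
    by (auto simp: L_def)
  have L_ex: "\<exists>n. x \<in> L f n" if "x \<in> space M" "f x \<noteq> 0" for f x
    using reals_Archimedean[of "norm (f x)"] that by (auto simp: L_def intro: less_imp_le)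
  obtain f where f: "f \<in> Lp_functions p M" "Lp_class p M f \<noteq> vzero X"
    using nz Lp_functions_zero[of p M] unfolding X_def Lp_carrier Lp_zero by blast
  then have f0: "\<not> (AE x in M. f x = 0)" by (simp add: X_def Lp_zero Lp_class_eq_iff)
  obtain n where n: "emeasure M (L f n) \<noteq> 0"
  proof (rule ccontr)
    assume "\<not> thesis"
    then have "AE x in M. \<forall>n. x \<notin> L f n"
      using L[OF f(1)] that by (auto simp: AE_all_countable null_sets_def intro!: AE_not_in)
    then have "AE x in M. f x = 0"
      using AE_space by eventually_elim (use L_ex in blast)
    then show False using f0 by contradiction
  qed
  define A where "A = L f n"
  have A: "A \<in> sets M" "emeasure M A < \<infinity>" "emeasure M A \<noteq> 0" using L[OF f(1)] n by (simp_all add: A_def)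
  have atom: "emeasure M E = 0 \<or> emeasure M (A - E) = 0" if E: "E \<in> sets M" "E \<subseteq> A" for E
  proof (rule disj)
    show "emeasure M E < \<infinity>" "emeasure M (A - E) < \<infinity>"
      using A E emeasure_mono[of E A M] emeasure_mono[of "A - E" A M] by (auto intro: le_less_trans)
  qed (use E A in auto)
  have "\<exists>c. AE x in M. g x = c * indicator A x" if g: "g \<in> Lp_functions p M" for g :: "'a \<Rightarrow> 'k"
  proof -
    obtain c where c: "AE x in M. x \<in> A \<longrightarrow> g x = c"
      using AE_constant_on_atom[OF A(1) Lp_functions_measurable[OF g] atom] by blast
    have "emeasure M (L g m - A) = 0" for m
    proof -
      have "emeasure M (L g m - A) < \<infinity>"
        using A L[OF g, of m] emeasure_mono[of "L g m - A" "L g m" M] by (auto intro: le_less_trans)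
      then show ?thesis using disj[of A "L g m - A"] A L[OF g, of m] by blast
    qed
    then have "AE x in M. \<forall>m. x \<notin> L g m - A"
      unfolding AE_all_countable using L[OF g] A by (intro allI AE_not_in) (simp add: null_sets_def)
    then have "AE x in M. g x = c * indicator A x"
      using c AE_space
    proof eventually_elim
      case (elim x)
      then show ?case using L_ex[of x g] by (cases "x \<in> A") auto
    qed
    then show ?thesis ..
  qed
  then show False using Lp_one_dimensionalI[of p M A] nz dim unfolding X_def by blast
qed

section \<open>Failure of transitivity\<close>

lemma le_Lp_seminorm_infinity:
  assumes f: "f \<in> Lp_functions \<infinity> M" and E: "E \<in> sets M" "emeasure M E \<noteq> 0"
    and le: "\<And>x. x \<in> E \<Longrightarrow> c \<le> norm (f x)"
  shows "c \<le> Lp_seminorm \<infinity> M f"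
proof (rule ccontr)
  assume less: "\<not> c \<le> Lp_seminorm \<infinity> M f"
  from AE_norm_le_Lp_seminorm_infinity[OF f] have "AE x in M. x \<notin> E"
    by eventually_elim (use le less in force)
  then have "emeasure M E = 0"
    using E sets.sets_into_space[OF E(1)] by (subst (asm) AE_iff_measurable[of E]) auto
  then show False using E by simp
qed

lemma Linfinity_not_locally_dominated:
  fixes M :: "'a measure"
  defines "X \<equiv> (Lp_space \<infinity> M :: ('k::{real_normed_field,euclidean_space}, ('a \<Rightarrow> 'k) set) normed_vs)"
  assumes E: "E \<in> sets M" "emeasure M E \<noteq> 0" "emeasure M (space M - E) \<noteq> 0"
  shows "\<exists>x\<in>unit_sphere X. \<not> locally_dominated X x"
proof -
  let ?N = "Lp_seminorm \<infinity> M :: ('a \<Rightarrow> 'k) \<Rightarrow> real" and ?cl = "Lp_class \<infinity> M :: ('a \<Rightarrow> 'k) \<Rightarrow> _"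
  have p: "1 \<le> (\<infinity>::ennreal)" by simp
  note [measurable] = E(1)
  have E': "space M - E \<in> sets M" by measurable
  have simple: "(\<lambda>x. c + d * indicator E x) \<in> Lp_functions \<infinity> M" for c d :: 'k
    using Lp_functions_infinity_iff[of "\<lambda>x. c + d * indicator E x" M]
    by (auto intro!: exI[of _ "norm c + norm d"] norm_triangle_le simp: norm_mult indicator_def)
  \<comment> \<open>E and its complement both have positive measure, so both values of the function
    count.\<close>
  have N: "?N (\<lambda>x. c + d * indicator E x) = max (norm c) (norm (c + d))" for c d
  proof (rule antisym)
    show "?N (\<lambda>x. c + d * indicator E x) \<le> max (norm c) (norm (c + d))"
      by (rule Lp_seminorm_infinity_le) (auto simp: indicator_def le_max_iff_disj)
    show "max (norm c) (norm (c + d)) \<le> ?N (\<lambda>x. c + d * indicator E x)"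
      using le_Lp_seminorm_infinity[OF simple E(1,2), of "norm (c + d)"]
        le_Lp_seminorm_infinity[OF simple E' E(3), of "norm c"] by simp
  qed
  define S where "S c d = ?cl (\<lambda>x. c + d * indicator E x)" for c d
  have S: "S c d \<in> vcarrier X" "vnorm X (S c d) = max (norm c) (norm (c + d))" for c d
    using simple N by (simp_all add: S_def X_def Lp_norm)
  have S_add: "vadd X (S c d) (vscale X t (S c' d')) = S (c + t * c') (d + t * d')" for c d t c' d'
  proof -
    have "(\<lambda>x. c + d * indicator E x + t * (c' + d' * indicator E x))
        = (\<lambda>x. (c + t * c') + (d + t * d') * indicator E x)" by (simp add: algebra_simps)
    then show ?thesis
      using simple Lp_functions_scale(1)[OF simple, of t] by (simp add: S_def X_def Lp_scale Lp_add)
  qed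
  have "\<not> locally_dominated X (S 1 0)"
  proof
    assume "locally_dominated X (S 1 0)"
    then obtain \<delta> where "\<delta> > 0" and dom: "\<And>y. \<lbrakk>y \<in> unit_sphere X; vnorm X (vminus X (S 1 0) y) < \<delta>\<rbrakk> \<Longrightarrow>
        dominated X (S 1 0) y \<and> dominated X y (S 1 0)"
      unfolding locally_dominated_def by blast
    \<comment> \<open>y = 1 - s 1_E is the midpoint of 1 and 1 - 2 s 1_E, and s \<le> 1/2 keeps the
      latter in the unit ball. Domination then yields ||1 + s V|| \<le> 1 and ||1 - s V|| \<le>
      1.\<close>
    define s where "s = min (1/2) (\<delta> / 2)"
    have s: "0 < s" "s < 1" "s < \<delta>" using \<open>\<delta> > 0\<close> by (auto simp: s_def)
    define y where "y = S 1 (- of_real s)"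
    have norm_1s: "norm (1 + of_real r :: 'k) = \<bar>1 + r\<bar>" for r
      using norm_of_real[of "1 + r", where 'a='k] by simp
    have "vnorm X y = 1" using s norm_1s[of "- s"] by (simp add: y_def S)
    then have "y \<in> unit_sphere X" by (simp add: unit_sphere_def y_def S)
    moreover have "vnorm X (vminus X (S 1 0) y) < \<delta>"
      using s by (simp add: vminus_def y_def S_add S)
    ultimately have "dominated X y (S 1 0)" using dom by blast
    then obtain V where V: "V \<in> vcarrier X" "vnorm X (vminus X V (S 0 1)) \<le> vnorm X (S 0 1) / 2"
      and le: "\<And>t. vnorm X (vadd X (S 1 0) (vscale X t V)) \<le> vnorm X (vadd X y (vscale X t (S 0 1)))"
      unfolding dominated_def using S(1) by blast
    obtain v where v: "v \<in> Lp_functions \<infinity> M" "V = ?cl v" using V by (auto simp: X_def Lp_carrier)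
    have N1: "?N (\<lambda>x. 1 + t * v x) \<le> 1" if "t = of_real s \<or> t = - of_real s" for t
    proof -
      have "vnorm X (vadd X (S 1 0) (vscale X t V)) = ?N (\<lambda>x. 1 + t * v x)"
        using simple[of 1 0] v Lp_functions_scale(1)[OF v(1), of t]
        by (simp add: S_def X_def Lp_scale Lp_add Lp_norm Lp_functions_add)
      moreover have "vnorm X (vadd X y (vscale X t (S 0 1))) \<le> 1"
        using s that norm_1s[of "- (2 * s)"] by (auto simp: y_def S_add S)
      ultimately show ?thesis using le[of t] by simp
    qed
    have AE1: "AE x in M. norm (1 + t * v x) \<le> 1" if "t = of_real s \<or> t = - of_real s" for t
    proof -
      have "(\<lambda>x. 1 + t * v x) \<in> Lp_functions \<infinity> M"
        using Lp_functions_add[OF p simple[of 1 0] Lp_functions_scale(1)[OF v(1), of t]] by simp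
      from AE_norm_le_Lp_seminorm_infinity[OF this] show ?thesis
        by eventually_elim (use N1[OF that] in linarith)
    qed
    have "AE x in M. norm (1 + of_real s * v x) \<le> 1" "AE x in M. norm (1 - of_real s * v x) \<le> 1"
      using AE1[of "of_real s"] AE1[of "- of_real s"] by simp_all
    \<comment> \<open>Extremality of the scalar 1: by the parallelogram law, |1 + z| \<le> 1 and |1
      - z| \<le> 1 force z = 0. But V = 0 is too far from 1_E.\<close>
    then have v0: "AE x in M. v x = 0"
    proof eventually_elim
      case (elim x)
      have "(norm (1 + of_real s * v x))\<^sup>2 \<le> 1" "(norm (1 - of_real s * v x))\<^sup>2 \<le> 1"
        using elim by (simp_all add: power_le_one)
      moreover have "n \<le> 0" if "a \<le> 1" "b \<le> 1" "a + b = 2 * (1\<^sup>2 + n)" for a b n :: real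
        using that by simp
      ultimately have "(norm (of_real s * v x))\<^sup>2 \<le> 0"
        using parallelogram_identity[of 1 "of_real s * v x"] unfolding norm_one by blast
      then show "v x = 0" using s by simp
    qed
    have "V = S 0 0" using v v0 simple[of 0 0] by (simp add: S_def Lp_class_eq_iff)
    then show False using V(2) by (simp add: vminus_def S_add S)
  qed
  moreover have "S 1 0 \<in> unit_sphere X" by (simp add: unit_sphere_def S)
  ultimately show ?thesis by blast
qed

text \<open>This is \<open>measure M A powr (1 / r)\<close> times the mean of f over A: the
  coordinate of the averaged function along the unit vector \<open>Lp_bump r M A\<close>.\<close>

definition Lp_average :: "real \<Rightarrow> 'a measure \<Rightarrow> 'a set \<Rightarrow> ('a \<Rightarrow> 'k::{real_normed_field,euclidean_space}) \<Rightarrow> 'k" where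
  "Lp_average r M A f = of_real (measure M A powr (1 / r - 1)) * (\<integral>x. indicator A x *\<^sub>R f x \<partial>M)"

definition Lp_bump :: "real \<Rightarrow> 'a measure \<Rightarrow> 'a set \<Rightarrow> 'a \<Rightarrow> 'k::{real_normed_field,euclidean_space}" where
  "Lp_bump r M A x = of_real (indicator A x * measure M A powr (- (1 / r)))"

context
  fixes M :: "'a measure" and p :: ennreal and r :: real
  assumes p: "1 \<le> p" "p \<noteq> \<infinity>" and r_def: "r = enn2real p"
begin

lemma r_ge_1: "1 \<le> r"
  using enn2real_ge_1[OF p] by (simp add: r_def)

lemma Lp_integrable_powr:
  "f \<in> Lp_functions p M \<Longrightarrow> integrable M (\<lambda>x. norm (f x) powr r)"
  using p by (simp add: Lp_functions_finite_iff r_def)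

context
  fixes A :: "'a set"
  assumes A: "A \<in> sets M" "emeasure M A \<noteq> 0" "emeasure M A < \<infinity>"
begin

lemma measure_bump_pos: "0 < measure M A"
  using A by (simp add: measure_def enn2real_positive_iff less_top zero_less_iff_neq_zero)

text \<open>On a set of finite measure the bound t \<le> 1 + t powr r does the work of Hoelder's
  inequality.\<close>

lemma integrable_restrict_finite:
  assumes f: "f \<in> Lp_functions p M"
  shows "integrable M (\<lambda>x. indicator A x *\<^sub>R (f x :: 'k::{real_normed_field,euclidean_space}))"
proof (rule Bochner_Integration.integrable_bound)
  note [measurable] = Lp_functions_measurable[OF f] A(1)
  show "integrable M (\<lambda>x. indicator A x + norm (f x) powr r :: real)"
    using A Lp_integrable_powr[OF f] by (auto intro!: integrable_real_indicator)
  have "t \<le> 1 + t powr r" if "0 \<le> t" for t :: real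
  proof (cases "t \<le> 1")
    case False
    then have "t powr 1 \<le> t powr r" using r_ge_1 by (intro powr_mono) auto
    then show ?thesis using False by simp
  qed (use that in \<open>simp add: add_increasing2\<close>)
  then have "norm (indicator A x *\<^sub>R f x) \<le> indicator A x + norm (f x) powr r" for x
    by (auto simp: indicator_def)
  then show "AE x in M. norm (indicator A x *\<^sub>R f x) \<le> norm (indicator A x + norm (f x) powr r)"
    by (auto intro: order_trans)
qed (use A(1) Lp_functions_measurable[OF f] in measurable)

lemma Lp_average_linear:
  assumes "f \<in> Lp_functions p M" "g \<in> Lp_functions p M"
  shows "Lp_average r M A (\<lambda>x. f x + t * g x) = Lp_average r M A f + t * Lp_average r M A g"
proof -
  have "(\<integral>x. indicator A x *\<^sub>R (f x + t * g x) \<partial>M)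
      = (\<integral>x. indicator A x *\<^sub>R f x + t * (indicator A x *\<^sub>R g x) \<partial>M)"
    by (simp only: scaleR_add_right mult_scaleR_right)
  also have "\<dots> = (\<integral>x. indicator A x *\<^sub>R f x \<partial>M) + t * (\<integral>x. indicator A x *\<^sub>R g x \<partial>M)"
    by (subst Bochner_Integration.integral_add[OF integrable_restrict_finite[OF assms(1)]
          integrable_mult_right[OF integrable_restrict_finite[OF assms(2)]]])
      (simp only: integral_mult_right_zero)
  finally show ?thesis by (simp add: Lp_average_def algebra_simps)
qed

lemma Lp_average_cong_AE:
  assumes "AE x in M. f x = g x" "f \<in> Lp_functions p M" "g \<in> Lp_functions p M"
  shows "Lp_average r M A f = Lp_average r M A g"
proof -
  note [measurable] = Lp_functions_measurable[OF assms(2)] Lp_functions_measurable[OF assms(3)] A(1)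
  have "(\<integral>x. indicator A x *\<^sub>R f x \<partial>M) = (\<integral>x. indicator A x *\<^sub>R g x \<partial>M)"
    using assms(1) by (intro integral_cong_AE) auto
  then show ?thesis by (simp add: Lp_average_def)
qed

text \<open>Jensen's inequality on \<open>A\<close>, obtained by integrating the tangent inequality at the mean \<open>m\<close>.\<close>

lemma Lp_average_le:
  assumes f: "f \<in> Lp_functions p M"
  shows "norm (Lp_average r M A f) powr r \<le> (\<integral>x. indicator A x * norm (f x) powr r \<partial>M)"
proof -
  note [measurable] = Lp_functions_measurable[OF f] A(1)
  define \<mu> I m where "\<mu> = measure M A" "I = (\<integral>x. indicator A x * norm (f x) \<partial>M)" "m = I / \<mu>"
  note defs = this
  have \<mu>: "\<mu> > 0" using measure_bump_pos by (simp add: defs)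
  have int: "integrable M (\<lambda>x. indicator A x * norm (f x) powr r)"
    using Lp_integrable_powr[OF f] A(1) integrable_mult_indicator[of A M "\<lambda>x. norm (f x) powr r"] by simp
  have int1: "integrable M (\<lambda>x. indicator A x * norm (f x))"
    using integrable_norm[OF integrable_restrict_finite[OF f]] by simp
  have I0: "I \<ge> 0" unfolding defs by (intro integral_nonneg_AE) auto
  have "norm (\<integral>x. indicator A x *\<^sub>R f x \<partial>M) \<le> I"
    using integral_norm_bound[of M "\<lambda>x. indicator A x *\<^sub>R f x"] by (simp add: defs)
  then have "norm (Lp_average r M A f) powr r \<le> (\<mu> powr (1 / r - 1) * I) powr r"
    using r_ge_1 unfolding Lp_average_def
    by (intro powr_mono2) (auto simp: norm_mult defs intro!: mult_left_mono)
  also have "\<dots> = \<mu> * m powr r"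
    using \<mu> I0 r_ge_1 by (simp add: defs(3) powr_mult powr_divide powr_powr left_diff_distrib powr_diff)
  also have "\<dots> \<le> (\<integral>x. indicator A x * norm (f x) powr r \<partial>M)"
  proof (cases "m = 0")
    case True
    then show ?thesis by (simp add: integral_nonneg_AE)
  next
    case False
    then have m: "m > 0" using I0 \<mu> by (simp add: defs(3))
    \<comment> \<open>Bernoulli's inequality at the quotient of norm (f x) by m, times m powr r. The
      left side integrates to exactly \<mu> * m powr r because m is the mean.\<close>
    have tangent: "m powr r * ((1 - r) * indicator A x + r / m * (indicator A x * norm (f x)))
        \<le> indicator A x * norm (f x) powr r" for x
    proof -
      have "m powr r * (1 + r * (norm (f x) / m - 1)) \<le> m powr r * (norm (f x) / m) powr r"
        using m r_ge_1 by (intro mult_left_mono Bernoulli_powr) auto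
      then show ?thesis using m by (simp add: indicator_def powr_divide algebra_simps)
    qed
    have int_ind: "integrable M (indicator A :: 'a \<Rightarrow> real)"
      using A by (intro integrable_real_indicator) auto
    have "\<mu> * m powr r = m powr r * ((1 - r) * \<mu> + r / m * I)"
      using m \<mu> by (simp add: defs(3) algebra_simps)
    also have "\<dots> = (\<integral>x. m powr r * ((1 - r) * indicator A x + r / m * (indicator A x * norm (f x))) \<partial>M)"
      using int1 int_ind A(1) sets.sets_into_space[OF A(1)] by (simp add: defs Int_absorb1 Int_absorb2)
    also have "\<dots> \<le> (\<integral>x. indicator A x * norm (f x) powr r \<partial>M)"
      using int int1 int_ind tangent by (intro integral_mono) auto
    finally show ?thesis .
  qed
  finally show ?thesis .
qed

lemma Lp_bump_functions: "(Lp_bump r M A :: 'a \<Rightarrow> 'k::{real_normed_field,euclidean_space}) \<in> Lp_functions p M"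
proof -
  have "(\<lambda>x. norm (Lp_bump r M A x :: 'k) powr r) = (\<lambda>x. indicator A x * (measure M A powr (- (1 / r))) powr r)"
    by (auto simp: Lp_bump_def norm_mult indicator_def fun_eq_iff)
  moreover have "(Lp_bump r M A :: 'a \<Rightarrow> 'k) \<in> borel_measurable M"
    unfolding Lp_bump_def using A(1) by measurable
  ultimately show ?thesis
    using p A by (simp add: Lp_functions_finite_iff flip: r_def)
qed

lemma Lp_average_bump: "Lp_average r M A (Lp_bump r M A :: 'a \<Rightarrow> 'k::{real_normed_field,euclidean_space}) = 1"
proof -
  have "(\<lambda>x. indicator A x *\<^sub>R (Lp_bump r M A x :: 'k)) = (\<lambda>x. indicator A x *\<^sub>R of_real (measure M A powr (- (1 / r))))"
    by (auto simp: Lp_bump_def indicator_def fun_eq_iff)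
  then have "Lp_average r M A (Lp_bump r M A :: 'a \<Rightarrow> 'k)
      = of_real (measure M A powr (1 / r - 1) * (measure M A * measure M A powr (- (1 / r))))"
    using A sets.sets_into_space[OF A(1)]
    by (simp add: Lp_average_def scaleR_conv_of_real Int_absorb1 Int_absorb2 less_top)
  also have "measure M A powr (1 / r - 1) * (measure M A * measure M A powr (- (1 / r))) = 1"
    using measure_bump_pos by (simp add: powr_diff powr_minus field_simps)
  finally show ?thesis by simp
qed

lemma Lp_average_bump_disjoint:
  assumes "A \<inter> B = {}"
  shows "Lp_average r M B (Lp_bump r M A :: 'a \<Rightarrow> 'k::{real_normed_field,euclidean_space}) = 0"
proof -
  have "(\<lambda>x. indicator B x *\<^sub>R (Lp_bump r M A x :: 'k)) = (\<lambda>x. 0)"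
    using assms by (auto simp: Lp_bump_def indicator_def fun_eq_iff)
  then show ?thesis by (simp add: Lp_average_def)
qed

end

context
  fixes A B :: "'a set"
  assumes A: "A \<in> sets M" "emeasure M A \<noteq> 0" "emeasure M A < \<infinity>"
    and B: "B \<in> sets M" "emeasure M B \<noteq> 0" "emeasure M B < \<infinity>"
    and AB: "A \<inter> B = {}"
begin

text \<open>The two Jensen inequalities add up because disjoint indicators sum to at most 1; this is
  the norm-one bound for the projection onto the span of the two bumps.\<close>

lemma Lp_average_two_le:
  assumes f: "f \<in> Lp_functions p M"
  shows "norm (Lp_average r M A f) powr r + norm (Lp_average r M B f) powr r \<le> Lp_seminorm p M f powr r"
proof -
  have int: "integrable M (\<lambda>x. indicator C x * norm (f x) powr r)" if "C \<in> sets M" for C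
    using integrable_mult_indicator[OF that Lp_integrable_powr[OF f]] by simp
  have "norm (Lp_average r M A f) powr r + norm (Lp_average r M B f) powr r
      \<le> (\<integral>x. indicator A x * norm (f x) powr r \<partial>M) + (\<integral>x. indicator B x * norm (f x) powr r \<partial>M)"
    by (intro add_mono Lp_average_le A B f)
  also have "\<dots> = (\<integral>x. indicator A x * norm (f x) powr r + indicator B x * norm (f x) powr r \<partial>M)"
    by (rule Bochner_Integration.integral_add[OF int[OF A(1)] int[OF B(1)], symmetric])
  also have "\<dots> \<le> (\<integral>x. norm (f x) powr r \<partial>M)"
    using int[OF A(1)] int[OF B(1)] AB Lp_integrable_powr[OF f]
    by (intro integral_mono) (auto simp: indicator_def)
  also have "\<dots> = Lp_seminorm p M f powr r" by (simp add: r_def Lp_seminorm_powr[OF p])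
  finally show ?thesis .
qed

lemma Lp_seminorm_bumps:
  fixes c d :: "'k::{real_normed_field,euclidean_space}"
  shows "Lp_seminorm p M (\<lambda>x. c * Lp_bump r M A x + d * Lp_bump r M B x) powr r = norm c powr r + norm d powr r"
proof -
  have *: "(measure M C powr (- (1 / r))) powr r = inverse (measure M C)" if "measure M C > 0" for C
  proof -
    have "(measure M C powr (- (1 / r))) powr r = measure M C powr - 1"
      unfolding powr_powr using r_ge_1 by simp
    then show ?thesis using that by (simp add: powr_minus)
  qed
  have \<mu>: "measure M A > 0" "measure M B > 0" using measure_bump_pos A B by blast+
  have eq: "norm (c * Lp_bump r M A x + d * Lp_bump r M B x) powr r
      = norm c powr r * inverse (measure M A) * indicator A x + norm d powr r * inverse (measure M B) * indicator B x" for x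
    using AB by (auto simp: Lp_bump_def indicator_def norm_mult powr_mult * \<mu>)
  have "Lp_seminorm p M (\<lambda>x. c * Lp_bump r M A x + d * Lp_bump r M B x) powr r
      = (\<integral>x. norm c powr r * inverse (measure M A) * indicator A x + norm d powr r * inverse (measure M B) * indicator B x \<partial>M)"
    unfolding eq[symmetric] by (rule Lp_seminorm_powr[OF p, folded r_def])
  also have "\<dots> = norm c powr r * inverse (measure M A) * measure M A + norm d powr r * inverse (measure M B) * measure M B"
    using A B sets.sets_into_space[OF A(1)] sets.sets_into_space[OF B(1)]
    by (subst Bochner_Integration.integral_add) (auto simp: Int_absorb1 Int_absorb2 less_top)
  finally show ?thesis using \<mu> by (simp add: mult.assoc)
qed

lemma Lp_not_locally_dominated:
  assumes "p \<noteq> 2"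
  defines "X \<equiv> (Lp_space p M :: ('k::{real_normed_field,euclidean_space}, ('a \<Rightarrow> 'k) set) normed_vs)"
  shows "\<exists>x\<in>unit_sphere X. \<not> locally_dominated X x"
proof -
  let ?cl = "Lp_class p M :: ('a \<Rightarrow> 'k) \<Rightarrow> _"
  have r2: "r \<noteq> 2"
  proof
    assume "r = 2"
    then have "ennreal (enn2real p) = 2" by (simp add: r_def)
    then show False using p assms by (simp add: less_top)
  qed
  define a b where "a = ?cl (Lp_bump r M A)" and "b = ?cl (Lp_bump r M B)"
  have bf: "(Lp_bump r M A :: 'a \<Rightarrow> 'k) \<in> Lp_functions p M" "(Lp_bump r M B :: 'a \<Rightarrow> 'k) \<in> Lp_functions p M"
    using Lp_bump_functions A B by blast+
  have norm_ab: "vnorm X (vadd X (vscale X c a) (vscale X d b)) powr r = norm c powr r + norm d powr r" for c d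
    using bf by (simp add: X_def a_def b_def Lp_scale Lp_add[OF p(1)] Lp_norm Lp_functions_scale
        Lp_functions_add[OF p(1)] Lp_seminorm_bumps)
  \<comment> \<open>The averages of a class are taken on a chosen representative; independence of
    the choice is what makes them linear on classes.\<close>
  have rep: "Lp_average r M C (Lp_rep (?cl f)) = Lp_average r M C f"
    if "f \<in> Lp_functions p M" "C \<in> sets M" "emeasure M C \<noteq> 0" "emeasure M C < \<infinity>" for f C
    using Lp_average_cong_AE[OF that(2-4) Lp_rep(2,1)[OF that(1)] that(1)] .
  have lin: "Lp_average r M C (Lp_rep (vadd X x (vscale X t y))) = Lp_average r M C (Lp_rep x) + t * Lp_average r M C (Lp_rep y)"
    if C: "C \<in> sets M" "emeasure M C \<noteq> 0" "emeasure M C < \<infinity>" and xy: "x \<in> vcarrier X" "y \<in> vcarrier X" for C x y t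
  proof -
    obtain f g where fg: "f \<in> Lp_functions p M" "x = ?cl f" "g \<in> Lp_functions p M" "y = ?cl g"
      using xy by (auto simp: X_def Lp_carrier)
    have tg: "(\<lambda>x. t * g x) \<in> Lp_functions p M" by (rule Lp_functions_scale(1)[OF fg(3)])
    have "Lp_average r M C (Lp_rep (vadd X x (vscale X t y))) = Lp_average r M C (\<lambda>x. f x + t * g x)"
      unfolding fg X_def Lp_scale[OF fg(3)] Lp_add[OF p(1) fg(1) tg]
      by (rule rep[OF Lp_functions_add[OF p(1) fg(1) tg] C])
    then show ?thesis
      using Lp_average_linear[OF C fg(1,3), of t] by (simp add: fg rep[OF fg(1) C] rep[OF fg(3) C])
  qed
  have "\<not> locally_dominated X a"
  proof (rule not_locally_dominated_lr[where r = r and b = b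
        and \<phi> = "\<lambda>x. Lp_average r M A (Lp_rep x)" and \<psi> = "\<lambda>x. Lp_average r M B (Lp_rep x)"])
    show "normed_vector_space X" unfolding X_def by (rule normed_vector_space_Lp[OF p(1)])
    show "a \<in> vcarrier X" "b \<in> vcarrier X" using bf by (simp_all add: X_def a_def b_def)
    fix x assume "x \<in> vcarrier X"
    then obtain f where "f \<in> Lp_functions p M" "x = ?cl f" by (auto simp: X_def Lp_carrier)
    then show "norm (Lp_average r M A (Lp_rep x)) powr r + norm (Lp_average r M B (Lp_rep x)) powr r \<le> vnorm X x powr r"
      using Lp_average_two_le[of f] by (simp add: rep[OF _ A] rep[OF _ B] X_def Lp_norm)
  qed (use r_ge_1 r2 norm_ab lin A B AB in
      \<open>simp_all add: a_def b_def rep bf Lp_average_bump Lp_average_bump_disjoint Int_commute\<close>)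
  moreover have "a \<in> unit_sphere X"
  proof -
    have "vnorm X a = Lp_seminorm p M (\<lambda>x. 1 * Lp_bump r M A x + 0 * Lp_bump r M B x :: 'k)"
      using bf by (simp add: a_def X_def Lp_norm)
    moreover have "\<dots> powr r = 1" by (subst Lp_seminorm_bumps) simp
    ultimately have "vnorm X a = 1"
      using r_ge_1 by (intro antisym powr_le_cancel[of "vnorm X a" r 1] powr_le_cancel[of 1 r "vnorm X a"]) simp_all
    then show ?thesis using bf by (simp add: unit_sphere_def a_def X_def)
  qed
  ultimately show ?thesis by blast
qed

end

end

proposition Lp_transitivity:
  fixes M :: "'a measure" and p :: ennreal and cj :: "'k::{real_normed_field,euclidean_space} \<Rightarrow> 'k"
  defines "X \<equiv> (Lp_space p M :: ('k, ('a \<Rightarrow> 'k) set) normed_vs)"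
  assumes p: "1 \<le> p" and cj: "scalar_conjugation cj" and nz: "vcarrier X \<noteq> {vzero X}"
  shows "uniformly_micro_semitransitive X \<longleftrightarrow> hilbertian_norm cj X"
    and "micro_transitive X \<longleftrightarrow> hilbertian_norm cj X"
    and "hilbertian_norm cj X \<longleftrightarrow> p = 2 \<or> one_dimensional X"
proof -
  interpret normed_vector_space X unfolding X_def by (rule normed_vector_space_Lp[OF p])
  have 1: "hilbertian_norm cj X" if "p = 2 \<or> one_dimensional X"
    using that L2_hilbertian[OF cj] one_dimensional_imp_hilbertian[OF cj] by (auto simp: X_def)
  have 2: "uniformly_micro_semitransitive X" "micro_transitive X" if "hilbertian_norm cj X"
    using hilbertian_imp_transitive[OF cj that] .
  have 3: "p = 2 \<or> one_dimensional X" if dom: "\<forall>x\<in>unit_sphere X. locally_dominated X x"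
  proof (rule ccontr)
    assume neg: "\<not> (p = 2 \<or> one_dimensional X)"
    have "\<exists>x\<in>unit_sphere X. \<not> locally_dominated X x"
    proof (cases "p = \<infinity>")
      case True
      obtain E where "E \<in> sets M" "emeasure M E \<noteq> 0" "emeasure M (space M - E) \<noteq> 0"
        using Lp_infinity_disjoint_sets[where 'k='k] nz neg unfolding X_def True by metis
      then show ?thesis unfolding X_def True by (rule Linfinity_not_locally_dominated)
    next
      case False
      obtain A B where AB: "A \<in> sets M" "B \<in> sets M" "A \<inter> B = {}" "emeasure M A \<noteq> 0" "emeasure M B \<noteq> 0"
          "emeasure M A < \<infinity>" "emeasure M B < \<infinity>"
        using Lp_disjoint_sets[where 'k='k, OF p False] nz neg unfolding X_def by metis
      then show ?thesis
        unfolding X_def using neg by (intro Lp_not_locally_dominated[OF p False refl AB(1,4,6,2,5,7,3)]) simp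
    qed
    then show False using dom by blast
  qed
  show "uniformly_micro_semitransitive X \<longleftrightarrow> hilbertian_norm cj X"
    using 1 2 3 locally_dominated_uniformly_micro_semitransitive by blast
  show "micro_transitive X \<longleftrightarrow> hilbertian_norm cj X"
    using 1 2 3 locally_dominated_micro_transitive by blast
  \<comment> \<open>The forward direction also passes through transitivity: a Hilbertian norm is
    micro-transitive, hence locally dominated at every unit vector.\<close>
  show "hilbertian_norm cj X \<longleftrightarrow> p = 2 \<or> one_dimensional X"
    using 1 2 3 locally_dominated_micro_transitive by blast
qed

theorem theorem3p1:
  fixes M :: "'a measure" and p :: ennreal
  assumes "1 \<le> p"
  shows
    "(let X = (Lp_space p M :: (real, ('a \<Rightarrow> real) set) normed_vs) in
        vcarrier X \<noteq> {vzero X} \<longrightarrow>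
          (uniformly_micro_semitransitive X \<longleftrightarrow> hilbertian_norm (\<lambda>c. c) X) \<and>
          (micro_transitive X \<longleftrightarrow> hilbertian_norm (\<lambda>c. c) X) \<and>
          (hilbertian_norm (\<lambda>c. c) X \<longleftrightarrow> p = 2 \<or> one_dimensional X)) \<and>
     (let X = (Lp_space p M :: (complex, ('a \<Rightarrow> complex) set) normed_vs) in
        vcarrier X \<noteq> {vzero X} \<longrightarrow>
          (uniformly_micro_semitransitive X \<longleftrightarrow> hilbertian_norm cnj X) \<and>
          (micro_transitive X \<longleftrightarrow> hilbertian_norm cnj X) \<and>
          (hilbertian_norm cnj X \<longleftrightarrow> p = 2 \<or> one_dimensional X))"
proof -
  have real: "scalar_conjugation (\<lambda>c::real. c)"
    by unfold_locales (simp_all add: power2_eq_square)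
  have complex: "scalar_conjugation cnj"
    by unfold_locales (simp_all add: complex_norm_square del: of_real_power)
  show ?thesis
    unfolding Let_def
    by (intro conjI impI Lp_transitivity[OF assms real] Lp_transitivity[OF assms complex])
qed

end
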